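(* Let $\Bbbk$ be a field of characteristic zero and $m\ge2$. With the objects defined in the context, the maps $$\bar h_m\circ g_m^{-1}:\mathrm{Dsh}_m^\vee\to W_m/(W_R)_m\qquad\text{and}\qquad \eta^{-1}\circ\bar h_m\circ g_m^{-1}:\mathrm{Dsh}_m^\vee\to D_{m,\bullet}$$ are isomorphisms of (weight-)graded vector spaces, where $D_{m,\bullet}$ is the depth $m$ component of $D_{\bullet\bullet}$.
   Context: $S(p,q)$ is the set of permutations $\sigma$ of $\{1,\dots,p+q\}$ increasing on $\{1,\dots,p\}$ and on $\{p+1,\dots,p+q\}$. ${}^\vee$ denotes the graded dual. Double shuffle space. For $m\ge2$ and a permutation $\sigma$ of $\{1,\dots,m\}$, $S_m$ and $T_\sigma$ are the algebra automorphisms of $\Bbbk[x_1,\dots,x_m]$ with $S_m(x_i)=x_i+\cdots+x_m$, $T_\sigma(x_i)=x_{\sigma^{-1}(i)}$. For $1\le l\le m-1$, $T_{m,*}^{(l)}=\sum_{\sigma\in S(l,m-l)}T_\sigma$ and $T_{m,\mathrm{sh}}^{(l)}=T_{m,*}^{(l)}\circ S_m$. $\mathrm{Dsh}_m=\bigcap_{l=1}^{m-1}(\ker T_{m,*}^{(l)}\cap\ker T_{m,\mathrm{sh}}^{(l)})\subset\Bbbk[x_1,\dots,x_m]$. Weight grading: the weight $k$ part ($k\ge m$) of $\Bbbk[x_1,\dots,x_m]$ and of $\mathrm{Dsh}_m$ consists of the homogeneous polynomials of degree $k-m$. $\mathrm{Dsh}_m'\subset\Bbbk[x_1,\dots,x_m]^\vee$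 is the space of forms vanishing on $\mathrm{Dsh}_m$. The spaces $W,W_R$. $W$ is the free vector space on symbols $I(n_1,\dots,n_m)$, $m\ge1$, $n_i\ge1$ (depth $m$, weight $n_1+\dots+n_m$). Set $$\{t_1:\cdots:t_m:t_{m+1}\}=\sum_{n_1,\dots,n_m\ge1}I(n_1,\dots,n_m)(t_1-t_{m+1})^{n_1-1}\cdots(t_m-t_{m+1})^{n_m-1},$$ $$\{t_1,\dots,t_m\}=\{t_1:t_1+t_2:\cdots:t_1+\cdots+t_m:0\}.$$ $W_\star$ is generated by the coefficients of $\sum_{\sigma\in S(p,q)}\{t_{\sigma^{-1}(1)}:\cdots:t_{\sigma^{-1}(p+q)}:t_{p+q+1}\}$ for all $p,q\ge1$; $W_{\mathrm{sh}}$ by the coefficients of $\sum_{\sigma\in S(p,q)}\{t_{\sigma^{-1}(1)},\dots,t_{\sigma^{-1}(p+q)}\}$ for all $p,q\ge1$; $W_{1,even}$ by the $I(2n)$, $n\ge1$. $W_R=W_\star+W_{\mathrm{sh}}+W_{1,even}$. $W_m$ and $(W_R)_m$ are the depth $m$ components. The maps. $h_m:\Bbbk[x_1,\dots,x_m]^\vee\to W_m$ is the graded isomorphism $h_m(\varphi)=\sum_{n_i\ge1}\varphi(x_1^{n_m-1}\cdots x_m^{n_1-1})I(n_1,\dots,n_m)$. It maps $\mathrm{Dsh}_m'$ onto $(W_R)_m$, and $\bar h_m:\Bbbk[x_1,\dots,x_m]^\vee/\mathrm{Dsh}_m'\to W_m/(W_R)_m$ is the induced map. $g_m:\Bbbk[x_1,\dots,x_m]^\vee/\mathrm{Dsh}_m'\to\mathrm{Dsh}_m^\vee$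 is the isomorphism induced by restriction of forms. The space $D_{\bullet\bullet}$ (Goncharov's $\widehat{\mathscr D}_{\bullet\bullet}(G)$ for $G=\{e\}$). It is the bigraded vector space generated by symbols $I_{n_1,\dots,n_m}(e,\dots,e)$, $m\ge1$, $n_i\ge1$ (depth $m$, weight $\sum n_i$). Set $$\{t_1:\cdots:t_m:t_{m+1}\}^{G}=\sum_{n_1,\dots,n_m\ge1}I_{n_1,\dots,n_m}(e,\dots,e)(t_1-t_{m+1})^{n_1-1}\cdots(t_m-t_{m+1})^{n_m-1},$$ $$\{t_1,\dots,t_m\}^{G}=\{t_1:t_1+t_2:\cdots:t_1+\cdots+t_m:0\}^{G}.$$ The relations are: (i) $\sum_{\sigma\in S(p,q)}\{t_{\sigma^{-1}(1)}:\cdots:t_{\sigma^{-1}(p+q)}:t_{p+q+1}\}^G=0$ and $\sum_{\sigma\in S(p,q)}\{t_{\sigma^{-1}(1)},\dots,t_{\sigma^{-1}(p+q)}\}^G=0$ for all $p,q\ge1$ (double shuffle relations); (ii) $\{t_1:\cdots:t_{m+1}\}^G=\{-t_1:\cdots:-t_{m+1}\}^G$ for all $m\ge1$ (distribution relations for $l=-1$). $\eta:D_{\bullet\bullet}\to W/W_R$ is the bigraded isomorphism induced by $I_{n_1,\dots,n_m}(e,\dots,e)\mapsto-I(n_1,\dots,n_m)$; in the claim $\eta$ also denotes its depth $m$ component. *)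

theory Defs
  imports Complex_Main "HOL-Library.Poly_Mapping" "HOL-Combinatorics.Permutations"
begin

section \<open>Graded vector spaces\<close>

text \<open>
  A graded vector space over the field type \<open>'k\<close>, given on a carrier set; the index type \<open>'i\<close>
  is \<open>nat\<close> for a weight grading and \<open>nat \<times> nat\<close> for a (depth, weight) bigrading.
\<close>

record ('i, 'k, 'v) graded_space =
  gcarrier :: "'v set"
  gadd :: "'v \<Rightarrow> 'v \<Rightarrow> 'v"
  gscale :: "'k \<Rightarrow> 'v \<Rightarrow> 'v"
  component :: "'i \<Rightarrow> 'v set"

definition graded_iso ::
    "('i, 'k, 'v) graded_space \<Rightarrow> ('i, 'k, 'w) graded_space \<Rightarrow> ('v \<Rightarrow> 'w) \<Rightarrow> bool" where
  "graded_iso V V' f \<longleftrightarrow>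
     bij_betw f (gcarrier V) (gcarrier V') \<and>
     (\<forall>u \<in> gcarrier V. \<forall>v \<in> gcarrier V. f (gadd V u v) = gadd V' (f u) (f v)) \<and>
     (\<forall>c. \<forall>v \<in> gcarrier V. f (gscale V c v) = gscale V' c (f v)) \<and>
     (\<forall>i. f ` component V i = component V' i)"

definition coset :: "('i, 'k, 'v) graded_space \<Rightarrow> 'v set \<Rightarrow> 'v \<Rightarrow> 'v set" where
  "coset V U v = gadd V v ` U"

definition quotient_space ::
    "('i, 'k, 'v) graded_space \<Rightarrow> 'v set \<Rightarrow> ('i, 'k, 'v set) graded_space" where
  "quotient_space V U =
     \<lparr> gcarrier = coset V U ` gcarrier V,
       gadd = (\<lambda>A B. \<Union>a\<in>A. \<Union>b\<in>B. coset V U (gadd V a b)),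
       gscale = (\<lambda>c A. \<Union>a\<in>A. coset V U (gscale V c a)),
       component = (\<lambda>i. coset V U ` component V i) \<rparr>"

text \<open>
  \<open>induced f\<close> sends a coset to the common value of \<open>f\<close> on its elements.
\<close>

definition induced :: "('v \<Rightarrow> 'w) \<Rightarrow> 'v set \<Rightarrow> 'w" where
  "induced f A = the_elem (f ` A)"

text \<open>
  The graded dual consists of the linear forms that are nonzero on only finitely many components.
  A form on \<open>V\<close> is a function on the ambient type that is \<open>0\<close> outside the carrier of \<open>V\<close>.
\<close>

definition graded_dual ::
    "('i, 'k::field, 'v) graded_space \<Rightarrow> ('i, 'k, 'v \<Rightarrow> 'k) graded_space" where
  "graded_dual V =
     (let dual = {\<phi>. (\<forall>v. v \<notin> gcarrier V \<longrightarrow> \<phi> v = 0) \<and>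
                      (\<forall>u \<in> gcarrier V. \<forall>v \<in> gcarrier V. \<phi> (gadd V u v) = \<phi> u + \<phi> v) \<and>
                      (\<forall>c. \<forall>v \<in> gcarrier V. \<phi> (gscale V c v) = c * \<phi> v) \<and>
                      finite {i. \<exists>v \<in> component V i. \<phi> v \<noteq> 0}}
      in \<lparr> gcarrier = dual,
           gadd = (\<lambda>\<phi> \<psi> v. \<phi> v + \<psi> v),
           gscale = (\<lambda>c \<phi> v. c * \<phi> v),
           component = (\<lambda>i. {\<phi> \<in> dual. \<forall>j. j \<noteq> i \<longrightarrow> (\<forall>v \<in> component V j. \<phi> v = 0)}) \<rparr>)"

definition restrict_form :: "'v set \<Rightarrow> ('v \<Rightarrow> 'k::zero) \<Rightarrow> 'v \<Rightarrow> 'k" where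
  "restrict_form A \<phi> v = (if v \<in> A then \<phi> v else 0)"

section \<open>Finitely supported functions as a vector space\<close>

definition pscale :: "'k::field \<Rightarrow> ('a \<Rightarrow>\<^sub>0 'k) \<Rightarrow> 'a \<Rightarrow>\<^sub>0 'k" where
  "pscale c p = Poly_Mapping.map ((*) c) p"

lemma lookup_pscale: "Poly_Mapping.lookup (pscale c p) a = c * Poly_Mapping.lookup p a"
  by (simp add: pscale_def Poly_Mapping.map.rep_eq when_def)

global_interpretation pm: vector_space "pscale :: 'k::field \<Rightarrow> ('a \<Rightarrow>\<^sub>0 'k) \<Rightarrow> 'a \<Rightarrow>\<^sub>0 'k"
  by unfold_locales
     (auto intro!: poly_mapping_eqI simp: lookup_pscale lookup_add algebra_simps)

section \<open>The double shuffle space\<close>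

text \<open>
  Polynomials in the variables \<open>x\<^sub>0, x\<^sub>1, \<dots>\<close> are finitely supported functions from exponents to
  coefficients; the multiplication of \<open>\<Rightarrow>\<^sub>0\<close> is convolution.
\<close>

type_synonym 'k mpol = "(nat \<Rightarrow>\<^sub>0 nat) \<Rightarrow>\<^sub>0 'k"

definition X :: "nat \<Rightarrow> 'k::field mpol" where
  "X i = Poly_Mapping.single (Poly_Mapping.single i 1) 1"

definition mdeg :: "(nat \<Rightarrow>\<^sub>0 nat) \<Rightarrow> nat" where
  "mdeg a = (\<Sum>i\<in>Poly_Mapping.keys a. Poly_Mapping.lookup a i)"

definition polys :: "nat \<Rightarrow> 'k::field mpol set" where
  "polys m = {p. \<forall>a \<in> Poly_Mapping.keys p. Poly_Mapping.keys a \<subseteq> {1..m}}"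

text \<open>In \<open>m\<close> variables, weight is degree plus \<open>m\<close>; the components of weight \<open>k < m\<close> are zero.\<close>

definition polys_wt :: "nat \<Rightarrow> nat \<Rightarrow> 'k::field mpol set" where
  "polys_wt m k = {p \<in> polys m. \<forall>a \<in> Poly_Mapping.keys p. mdeg a + m = k}"

definition poly_space :: "nat \<Rightarrow> (nat, 'k::field, 'k mpol) graded_space" where
  "poly_space m = \<lparr> gcarrier = polys m, gadd = (+), gscale = pscale, component = polys_wt m \<rparr>"

text \<open>The algebra endomorphism with \<open>x\<^sub>i \<mapsto> f i\<close>.\<close>

definition poly_subst :: "(nat \<Rightarrow> 'k::field mpol) \<Rightarrow> 'k mpol \<Rightarrow> 'k mpol" where
  "poly_subst f p =
     (\<Sum>a\<in>Poly_Mapping.keys p. pscale (Poly_Mapping.lookup p a)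
        (\<Prod>i\<in>Poly_Mapping.keys a. f i ^ Poly_Mapping.lookup a i))"

definition shuffles :: "nat \<Rightarrow> nat \<Rightarrow> (nat \<Rightarrow> nat) set" where
  "shuffles p q =
     {\<sigma>. \<sigma> permutes {1..p + q} \<and> strict_mono_on {1..p} \<sigma> \<and> strict_mono_on {p + 1..p + q} \<sigma>}"

definition S_map :: "nat \<Rightarrow> 'k::field mpol \<Rightarrow> 'k mpol" where
  "S_map m = poly_subst (\<lambda>i. \<Sum>j = i..m. X j)"

definition T_perm :: "(nat \<Rightarrow> nat) \<Rightarrow> 'k::field mpol \<Rightarrow> 'k mpol" where
  "T_perm \<sigma> = poly_subst (\<lambda>i. X (inv \<sigma> i))"

definition T_star :: "nat \<Rightarrow> nat \<Rightarrow> 'k::field mpol \<Rightarrow> 'k mpol" where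
  "T_star m l p = (\<Sum>\<sigma>\<in>shuffles l (m - l). T_perm \<sigma> p)"

definition T_sh :: "nat \<Rightarrow> nat \<Rightarrow> 'k::field mpol \<Rightarrow> 'k mpol" where
  "T_sh m l = T_star m l \<circ> S_map m"

definition Dsh :: "nat \<Rightarrow> 'k::field mpol set" where
  "Dsh m = {p \<in> polys m. \<forall>l \<in> {1..m - 1}. T_star m l p = 0 \<and> T_sh m l p = 0}"

definition Dsh_space :: "nat \<Rightarrow> (nat, 'k::field, 'k mpol) graded_space" where
  "Dsh_space m =
     \<lparr> gcarrier = Dsh m, gadd = (+), gscale = pscale, component = (\<lambda>k. Dsh m \<inter> polys_wt m k) \<rparr>"

definition Dsh' :: "nat \<Rightarrow> ('k::field mpol \<Rightarrow> 'k) set" where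
  "Dsh' m = {\<phi> \<in> gcarrier (graded_dual (poly_space m)). \<forall>p \<in> Dsh m. \<phi> p = 0}"

section \<open>The spaces \<open>W\<close> and \<open>W\<^sub>R\<close>\<close>

text \<open>
  The symbol \<open>I(n\<^sub>1,\<dots>,n\<^sub>m)\<close> is the basis vector at the list \<open>[n\<^sub>1,\<dots>,n\<^sub>m]\<close>.
\<close>

type_synonym 'k symb = "nat list \<Rightarrow>\<^sub>0 'k"

definition symb :: "nat list \<Rightarrow> 'k::field symb" where
  "symb n = Poly_Mapping.single n 1"

definition indices :: "nat \<Rightarrow> nat list set" where
  "indices m = {n. length n = m \<and> (\<forall>i \<in> set n. 1 \<le> i)}"

definition W :: "'k::field symb set" where
  "W = {w. Poly_Mapping.keys w \<subseteq> (\<Union>m\<in>{1..}. indices m)}"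

definition W_depth :: "nat \<Rightarrow> 'k::field symb set" where
  "W_depth m = {w \<in> W. \<forall>n \<in> Poly_Mapping.keys w. length n = m}"

definition W_depth_wt :: "nat \<Rightarrow> nat \<Rightarrow> 'k::field symb set" where
  "W_depth_wt m k = {w \<in> W_depth m. \<forall>n \<in> Poly_Mapping.keys w. sum_list n = k}"

definition W_space :: "(nat \<times> nat, 'k::field, 'k symb) graded_space" where
  "W_space = \<lparr> gcarrier = W, gadd = (+), gscale = pscale, component = (\<lambda>(m, k). W_depth_wt m k) \<rparr>"

definition W_depth_space :: "nat \<Rightarrow> (nat, 'k::field, 'k symb) graded_space" where
  "W_depth_space m =
     \<lparr> gcarrier = W_depth m, gadd = (+), gscale = pscale, component = W_depth_wt m \<rparr>"

text \<open>
  A power series in \<open>t\<^sub>1, t\<^sub>2, \<dots>\<close> with coefficients in \<open>W\<close> is given by its coefficients, as a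
  function of the exponent \<open>a\<close>.  Below, \<open>ts = [u\<^sub>1, \<dots>, u\<^sub>m, u\<^sub>m\<^sub>+\<^sub>1]\<close> is a list of linear forms in the
  \<open>t\<^sub>i\<close> (represented by \<open>X i\<close>), and \<open>colon_series ts\<close> is \<open>{u\<^sub>1 : \<dots> : u\<^sub>m : u\<^sub>m\<^sub>+\<^sub>1}\<close>.  Because the forms
  are homogeneous of degree 1, only finitely many \<open>n\<close> contribute to each exponent.
\<close>

definition colon_series :: "'k::field mpol list \<Rightarrow> (nat \<Rightarrow>\<^sub>0 nat) \<Rightarrow> 'k symb" where
  "colon_series ts a =
     (let m = length ts - 1;
          c = (\<lambda>n. Poly_Mapping.lookup (\<Prod>i<m. (ts ! i - ts ! m) ^ (n ! i - 1)) a)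
      in \<Sum>n | n \<in> indices m \<and> c n \<noteq> 0. pscale (c n) (symb n))"

definition comma_series :: "'k::field mpol list \<Rightarrow> (nat \<Rightarrow>\<^sub>0 nat) \<Rightarrow> 'k symb" where
  "comma_series us =
     colon_series (map (\<lambda>i. sum_list (take i us)) [1..<length us + 1] @ [0])"

definition star_coeffs :: "'k::field symb set" where
  "star_coeffs =
     {\<Sum>\<sigma>\<in>shuffles p q.
        colon_series (map (\<lambda>i. X (inv \<sigma> i)) [1..<p + q + 1] @ [X (p + q + 1)]) a
      | p q a. 1 \<le> p \<and> 1 \<le> q}"

definition sh_coeffs :: "'k::field symb set" where
  "sh_coeffs =
     {\<Sum>\<sigma>\<in>shuffles p q. comma_series (map (\<lambda>i. X (inv \<sigma> i)) [1..<p + q + 1]) a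
      | p q a. 1 \<le> p \<and> 1 \<le> q}"

definition W_star :: "'k::field symb set" where
  "W_star = pm.span star_coeffs"

definition W_sh :: "'k::field symb set" where
  "W_sh = pm.span sh_coeffs"

definition W_1even :: "'k::field symb set" where
  "W_1even = pm.span {symb [2 * n] | n. 1 \<le> n}"

definition W_R :: "'k::field symb set" where
  "W_R = {u + v + w | u v w. u \<in> W_star \<and> v \<in> W_sh \<and> w \<in> W_1even}"

definition W_R_depth :: "nat \<Rightarrow> 'k::field symb set" where
  "W_R_depth m = W_R \<inter> W_depth m"

section \<open>The maps \<open>h\<^sub>m\<close> and \<open>g\<^sub>m\<close>\<close>

text \<open>Lists are indexed from 0, so the exponent of \<open>x\<^sub>i\<close> is \<open>n\<^sub>m\<^sub>+\<^sub>1\<^sub>-\<^sub>i - 1 = n ! (m - i) - 1\<close>.\<close>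

definition h_map :: "nat \<Rightarrow> ('k::field mpol \<Rightarrow> 'k) \<Rightarrow> 'k symb" where
  "h_map m \<phi> =
     (let c = (\<lambda>n. \<phi> (\<Prod>i = 1..m. X i ^ (n ! (m - i) - 1)))
      in \<Sum>n | n \<in> indices m \<and> c n \<noteq> 0. pscale (c n) (symb n))"

definition dual_mod_Dsh' :: "nat \<Rightarrow> (nat, 'k::field, ('k mpol \<Rightarrow> 'k) set) graded_space" where
  "dual_mod_Dsh' m = quotient_space (graded_dual (poly_space m)) (Dsh' m)"

definition W_mod_R :: "nat \<Rightarrow> (nat, 'k::field, 'k symb set) graded_space" where
  "W_mod_R m = quotient_space (W_depth_space m) (W_R_depth m)"

definition h_bar :: "nat \<Rightarrow> ('k::field mpol \<Rightarrow> 'k) set \<Rightarrow> 'k symb set" where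
  "h_bar m = induced (\<lambda>\<phi>. coset (W_depth_space m) (W_R_depth m) (h_map m \<phi>))"

definition g_map :: "nat \<Rightarrow> ('k::field mpol \<Rightarrow> 'k) set \<Rightarrow> 'k mpol \<Rightarrow> 'k" where
  "g_map m = induced (restrict_form (Dsh m))"

definition g_inv :: "nat \<Rightarrow> ('k::field mpol \<Rightarrow> 'k) \<Rightarrow> ('k mpol \<Rightarrow> 'k) set" where
  "g_inv m = inv_into (gcarrier (dual_mod_Dsh' m)) (g_map m)"

section \<open>The space \<open>D\<close>\<close>

text \<open>
  The generators \<open>I\<^bsub>n\<^sub>1,\<dots>,n\<^sub>m\<^esub>(e,\<dots>,e)\<close> have the same indices as the symbols \<open>I(n\<^sub>1,\<dots>,n\<^sub>m)\<close>, so the free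
  space on them is again \<open>W\<close>, and their generating series are again \<open>colon_series\<close> and
  \<open>comma_series\<close>.
\<close>

definition distribution_coeffs :: "'k::field symb set" where
  "distribution_coeffs =
     {colon_series (map X [1..<m + 2]) a - colon_series (map (\<lambda>i. - X i) [1..<m + 2]) a
      | m a. 1 \<le> m}"

definition D_relations :: "'k::field symb set" where
  "D_relations = pm.span (star_coeffs \<union> sh_coeffs \<union> distribution_coeffs)"

definition D_space :: "(nat \<times> nat, 'k::field, 'k symb set) graded_space" where
  "D_space = quotient_space W_space D_relations"

definition D_depth_space :: "nat \<Rightarrow> (nat, 'k::field, 'k symb set) graded_space" where
  "D_depth_space m =
     \<lparr> gcarrier = coset W_space D_relations ` W_depth m,
       gadd = gadd D_space,
       gscale = gscale D_space,
       component = (\<lambda>k. component D_space (m, k)) \<rparr>"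

text \<open>The linear map with \<open>I\<^bsub>n\<^esub>(e,\<dots>,e) \<mapsto> - I(n)\<close> on free spaces.\<close>

definition eta_free :: "'k::field symb \<Rightarrow> 'k symb" where
  "eta_free w = (\<Sum>n\<in>Poly_Mapping.keys w. pscale (Poly_Mapping.lookup w n) (- symb n))"

definition eta :: "'k::field symb set \<Rightarrow> 'k symb set" where
  "eta = induced (\<lambda>w. coset W_space W_R (eta_free w))"

text \<open>
  The depth \<open>m\<close> component of \<open>W/W\<^sub>R\<close> is identified with \<open>W\<^sub>m/(W\<^sub>R)\<^sub>m\<close> by intersecting cosets with
  \<open>W\<^sub>m\<close>: \<open>(w + W\<^sub>R) \<inter> W\<^sub>m = w + (W\<^sub>R)\<^sub>m\<close> for \<open>w \<in> W\<^sub>m\<close>.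
\<close>

definition eta_depth :: "nat \<Rightarrow> 'k::field symb set \<Rightarrow> 'k symb set" where
  "eta_depth m A = eta A \<inter> W_depth m"

definition eta_inv :: "nat \<Rightarrow> 'k::field symb set \<Rightarrow> 'k symb set" where
  "eta_inv m = inv_into (gcarrier (D_depth_space m)) (eta_depth m)"

end

(*
  The coefficients of T_star and T_sh applied to a polynomial p are, up to an invertible linear change
  of variables, the values at p of the coefficients of the double shuffle series, when the symbol
  I(n_1,...,n_m) is read as the functional extracting the coefficient of
  x_1^(n_m - 1) ... x_m^(n_1 - 1).  Hence Dsh_m is the annihilator of the depth m double shuffle
  relations, and since these are homogeneous and the weight components are finite-dimensional, the
  forms vanishing on Dsh_m are exactly the relations.

  It remains to see that the distribution relations add nothing but I(2n) = 0 in depth 1, that is, that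
  Dsh_m has no nonzero element p of odd degree for m >= 2.  Write F(t_0,...,t_m) for
  p(t_1 - t_0,...,t_m - t_0).  The antipode of the shuffle algebra turns the shuffle relations of p
  and of S_m p into reversal symmetries; together with oddness they give
  F(t_1,...,t_m,t_0) = - F(t_0,...,t_m).  For even m, rotating m + 1 times gives F = - F.  For odd m,
  compare the relation for inserting one letter into a cyclic word of length m with its rotation.
*)

theory Submission
  imports Defs "HOL-Library.Function_Algebras"
begin

section \<open>Substitution\<close>

text \<open>None of g_m, the map induced by h_m, and eta gets an isomorphism proof of its own. All
  the spaces are images of the graded dual of the polynomial ring: by restriction to Dsh_m, by h_m
  followed by a quotient map, and by the same with a sign. It suffices that these surjections
  respect weights and have the same fibres. Two obstacles shape the rest. h_m reverses the order of
  the variables, so a (p,q)-shuffle relation corresponds to \<open>T_star\<close> with index q, and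
  permutations have to be conjugated by the reversal. And the spaces are infinite-dimensional: a
  form separating a symbol from the relations, or extending a form from Dsh_m, may be nonzero in
  infinitely many weights. Each time it is cut down to finitely many weights, which works since the
  relations and Dsh_m are graded. In the parity argument the rotation has sign -1 and order m + 1.
  For odd m these are compatible, so the rotation alone yields no contradiction there.\<close>

lemma pscale_conv_mult: "pscale c p = Poly_Mapping.single 0 c * p"
  by (simp add: pscale_def mult_map_scale_conv_mult)

lemma pscale_single: "pscale c (Poly_Mapping.single a d) = Poly_Mapping.single a (c * d)"
  by (rule poly_mapping_eqI) (simp add: lookup_pscale lookup_single when_def)

lemma poly_mapping_sum_singles:
  assumes "finite A" "Poly_Mapping.keys p \<subseteq> A"
  shows "(\<Sum>a\<in>A. pscale (Poly_Mapping.lookup p a) (Poly_Mapping.single a 1)) = p"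
proof (rule poly_mapping_eqI)
  fix b
  have "Poly_Mapping.lookup (\<Sum>a\<in>A. pscale (Poly_Mapping.lookup p a) (Poly_Mapping.single a 1)) b
      = (\<Sum>a\<in>A. if a = b then Poly_Mapping.lookup p a else 0)"
    by (simp add: lookup_sum lookup_pscale lookup_single when_def if_distrib cong: if_cong)
  also have "\<dots> = Poly_Mapping.lookup p b"
    using assms by (auto simp: sum.delta in_keys_iff)
  finally show "Poly_Mapping.lookup (\<Sum>a\<in>A. pscale (Poly_Mapping.lookup p a)
      (Poly_Mapping.single a 1)) b = Poly_Mapping.lookup p b" .
qed

lemma poly_mapping_induct [case_names single add]:
  fixes p :: "'a \<Rightarrow>\<^sub>0 'k::field"
  assumes single: "\<And>a c. P (Poly_Mapping.single a c)"
    and add: "\<And>p q. P p \<Longrightarrow> P q \<Longrightarrow> P (p + q)"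
  shows "P p"
proof -
  have "P 0" using single[of undefined 0] by simp
  then have "P (\<Sum>a\<in>A. pscale (f a) (Poly_Mapping.single a 1))" for A and f :: "'a \<Rightarrow> 'k"
    by (induction A rule: infinite_finite_induct) (auto simp: pscale_single intro: single add)
  from this[of "Poly_Mapping.lookup p" "Poly_Mapping.keys p"] show ?thesis
    by (simp add: poly_mapping_sum_singles)
qed

section \<open>Evaluation of monomials, and the degree\<close>

definition monom_at :: "(nat \<Rightarrow> 'k::field mpol) \<Rightarrow> (nat \<Rightarrow>\<^sub>0 nat) \<Rightarrow> 'k mpol" where
  "monom_at f a = (\<Prod>i\<in>Poly_Mapping.keys a. f i ^ Poly_Mapping.lookup a i)"

lemma monom_at_superset:
  assumes "finite A" "Poly_Mapping.keys a \<subseteq> A"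
  shows "monom_at f a = (\<Prod>i\<in>A. f i ^ Poly_Mapping.lookup a i)"
  unfolding monom_at_def
  by (rule prod.mono_neutral_left) (use assms in \<open>auto simp: in_keys_iff\<close>)

lemma monom_at_add: "monom_at f (a + b) = monom_at f a * monom_at f b"
proof -
  let ?A = "Poly_Mapping.keys a \<union> Poly_Mapping.keys b"
  have "Poly_Mapping.keys (a + b) \<subseteq> ?A" by (rule keys_add)
  then show ?thesis
    by (simp add: monom_at_superset[of ?A] lookup_add power_add prod.distrib)
qed

lemma mdeg_superset:
  assumes "finite A" "Poly_Mapping.keys a \<subseteq> A"
  shows "mdeg a = (\<Sum>i\<in>A. Poly_Mapping.lookup a i)"
  unfolding mdeg_def
  by (rule sum.mono_neutral_left) (use assms in \<open>auto simp: in_keys_iff\<close>)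

lemma mdeg_add: "mdeg (a + b) = mdeg a + mdeg b"
proof -
  let ?A = "Poly_Mapping.keys a \<union> Poly_Mapping.keys b"
  have "Poly_Mapping.keys (a + b) \<subseteq> ?A" by (rule keys_add)
  then show ?thesis
    by (simp add: mdeg_superset[of ?A] lookup_add sum.distrib)
qed

lemma single_1_power:
  "(Poly_Mapping.single a 1 :: 'k::field mpol) ^ n = Poly_Mapping.single (\<Sum>i<n. a) 1"
  by (induction n) (simp_all add: mult_single add.commute del: sum_constant)

lemma sum_const_single: "(\<Sum>j<n. Poly_Mapping.single i (1::nat)) = Poly_Mapping.single i n"
  by (induction n) (simp_all add: single_add[symmetric])

lemma X_power: "(X i :: 'k::field mpol) ^ n = Poly_Mapping.single (Poly_Mapping.single i n) 1"
  unfolding X_def single_1_power sum_const_single ..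

lemma prod_single_1:
  "finite A \<Longrightarrow> (\<Prod>i\<in>A. Poly_Mapping.single (b i) (1::'k::field))
     = Poly_Mapping.single (\<Sum>i\<in>A. b i :: nat \<Rightarrow>\<^sub>0 nat) 1"
  by (induction rule: finite_induct) (simp_all add: mult_single)

lemma prod_X_power:
  "finite A \<Longrightarrow> (\<Prod>i\<in>A. (X i :: 'k::field mpol) ^ e i)
     = Poly_Mapping.single (\<Sum>i\<in>A. Poly_Mapping.single i (e i)) 1"
  by (simp add: X_power prod_single_1)

lemma lookup_sum_single:
  "finite A \<Longrightarrow> Poly_Mapping.lookup (\<Sum>i\<in>A. Poly_Mapping.single i (e i :: nat)) j = (if j \<in> A then e j else 0)"
  by (simp add: lookup_sum lookup_single when_def sum.delta)

lemma monom_at_X: "monom_at X a = Poly_Mapping.single a 1"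
proof -
  have "(\<Sum>i\<in>Poly_Mapping.keys a. Poly_Mapping.single i (Poly_Mapping.lookup a i)) = a"
    by (rule poly_mapping_eqI) (simp add: lookup_sum_single in_keys_iff)
  then show ?thesis by (simp add: monom_at_def prod_X_power)
qed

text \<open>Cancellation can make the keys of p + q smaller than the union of the keys, so
  additivity is proved over a common finite index set, where the added terms have coefficient
  0.\<close>

lemma poly_subst_superset:
  assumes "finite A" "Poly_Mapping.keys p \<subseteq> A"
  shows "poly_subst f p = (\<Sum>a\<in>A. pscale (Poly_Mapping.lookup p a) (monom_at f a))"
  unfolding poly_subst_def monom_at_def[symmetric]
  by (rule sum.mono_neutral_left) (use assms in \<open>auto simp: in_keys_iff\<close>)

lemma poly_subst_0 [simp]: "poly_subst f 0 = 0"
  by (simp add: poly_subst_def)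

lemma poly_subst_add: "poly_subst f (p + q) = poly_subst f p + poly_subst f q"
proof -
  let ?A = "Poly_Mapping.keys p \<union> Poly_Mapping.keys q"
  have "Poly_Mapping.keys (p + q) \<subseteq> ?A" by (rule keys_add)
  then show ?thesis
    by (simp add: poly_subst_superset[of ?A] lookup_add pm.scale_left_distrib sum.distrib)
qed

lemma poly_subst_pscale: "poly_subst f (pscale c p) = pscale c (poly_subst f p)"
proof -
  have "Poly_Mapping.keys (pscale c p) \<subseteq> Poly_Mapping.keys p"
    by (auto simp: in_keys_iff lookup_pscale)
  then show ?thesis
    by (simp add: poly_subst_superset[of "Poly_Mapping.keys p"] lookup_pscale pm.scale_sum_right)
qed

lemma poly_subst_uminus: "poly_subst f (- p) = - poly_subst f p"
  using poly_subst_pscale[of f "-1" p] by simp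

lemma poly_subst_diff: "poly_subst f (p - q) = poly_subst f p - poly_subst f q"
  using poly_subst_add[of f p "- q"] by (simp add: poly_subst_uminus)

lemma poly_subst_sum: "poly_subst f (\<Sum>i\<in>I. p i) = (\<Sum>i\<in>I. poly_subst f (p i))"
  by (induction I rule: infinite_finite_induct) (simp_all add: poly_subst_add)

lemma poly_subst_single: "poly_subst f (Poly_Mapping.single a c) = pscale c (monom_at f a)"
  by (subst poly_subst_superset[of "{a}"]) auto

lemma poly_subst_X [simp]: "poly_subst f (X i) = f i"
  by (simp add: X_def poly_subst_single monom_at_def)

lemma poly_subst_1 [simp]: "poly_subst f 1 = 1"
  by (simp add: single_one[symmetric] poly_subst_single monom_at_def del: single_one)

lemma poly_subst_id: "poly_subst X p = p"
  by (simp add: poly_subst_superset[OF finite_keys subset_refl] monom_at_X poly_mapping_sum_singles)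

lemma poly_subst_mult: "poly_subst f (p * q) = poly_subst f p * poly_subst f q"
proof -
  have 1: "poly_subst f (Poly_Mapping.single a c * q) = poly_subst f (Poly_Mapping.single a c) * poly_subst f q"
    for a c q
  proof (induction q rule: poly_mapping_induct)
    case (single b d)
    then show ?case
      by (simp add: mult_single poly_subst_single monom_at_add pscale_conv_mult
          mult.assoc mult.left_commute flip: mult_single[of 0 c 0 d, simplified])
  next
    case (add q r)
    then show ?case by (simp add: distrib_left poly_subst_add)
  qed
  show ?thesis
    by (induction p rule: poly_mapping_induct) (simp_all add: 1 distrib_right poly_subst_add)
qed

lemma poly_subst_power: "poly_subst f (p ^ n) = poly_subst f p ^ n"
  by (induction n) (simp_all add: poly_subst_mult)

lemma poly_subst_prod: "poly_subst f (\<Prod>i\<in>I. p i) = (\<Prod>i\<in>I. poly_subst f (p i))"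
  by (induction I rule: infinite_finite_induct) (simp_all add: poly_subst_mult)

lemma poly_subst_poly_subst:
  "poly_subst f (poly_subst g p) = poly_subst (\<lambda>i. poly_subst f (g i)) p"
  unfolding poly_subst_def[of g] poly_subst_def[of "\<lambda>i. poly_subst f (g i)"]
  by (simp add: poly_subst_sum poly_subst_pscale poly_subst_prod poly_subst_power)

lemma poly_subst_cong:
  assumes "p \<in> polys m" "\<And>i. i \<in> {1..m} \<Longrightarrow> f i = g i"
  shows "poly_subst f p = poly_subst g p"
  unfolding poly_subst_def using assms
  by (intro sum.cong refl arg_cong[of _ _ "pscale _"] prod.cong) (auto simp: polys_def subset_iff)

text \<open>A polynomial of weight k has degree k - m. The exponent k + m has the same parity and
  avoids truncated subtraction.\<close>

lemma poly_subst_uminus_args: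
  assumes "p \<in> polys_wt m k"
  shows "poly_subst (\<lambda>i. - f i) p = (- 1) ^ (k + m) * poly_subst f p"
proof -
  have "monom_at (\<lambda>i. - f i) a = (- 1) ^ mdeg a * monom_at f a" for a
    by (simp add: monom_at_def mdeg_def power_minus[of "f _"] prod.distrib power_sum)
  moreover have "(- 1 :: 'a mpol) ^ (k + m) = (- 1) ^ mdeg a" if "a \<in> Poly_Mapping.keys p" for a
  proof -
    have "k = mdeg a + m" using assms that by (auto simp: polys_wt_def)
    then show ?thesis by (simp add: power_add flip: power_mult_distrib)
  qed
  ultimately show ?thesis
    unfolding poly_subst_def monom_at_def[symmetric] sum_distrib_left
    by (intro sum.cong) (simp_all add: pscale_conv_mult mult.left_commute)
qed

section \<open>Sums over shuffles\<close>

declare upt_Suc [simp del]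

text \<open>Shuffles are counted with multiplicity, whereas the set \<open>List.shuffles\<close>
  identifies equal words when letters repeat; the letters substituted below are polynomials that may
  coincide. The argument \<open>G\<close> absorbs the prefix already chosen.\<close>

fun shuffle_sum :: "('a list \<Rightarrow> 'b::comm_monoid_add) \<Rightarrow> 'a list \<Rightarrow> 'a list \<Rightarrow> 'b" where
  "shuffle_sum G [] ys = G ys"
| "shuffle_sum G (x # xs) [] = G (x # xs)"
| "shuffle_sum G (x # xs) (y # ys) =
     shuffle_sum (\<lambda>zs. G (x # zs)) xs (y # ys) + shuffle_sum (\<lambda>zs. G (y # zs)) (x # xs) ys"

lemma shuffle_sum_Nil2 [simp]: "shuffle_sum G xs [] = G xs"
  by (cases xs) auto

lemma shuffle_sum_map: "shuffle_sum G (map f xs) (map f ys) = shuffle_sum (\<lambda>zs. G (map f zs)) xs ys"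
  by (induction xs ys arbitrary: G rule: List.shuffles.induct) auto

lemma sum_shuffles_eq_shuffle_sum:
  assumes "distinct (xs @ ys)"
  shows "(\<Sum>zs\<in>List.shuffles xs ys. G zs) = shuffle_sum G xs ys"
  using assms
proof (induction G xs ys rule: shuffle_sum.induct)
  case (3 G x xs y ys)
  have "(\<Sum>zs\<in>List.shuffles (x # xs) (y # ys). G zs)
      = (\<Sum>zs\<in>(#) x ` List.shuffles xs (y # ys). G zs) + (\<Sum>zs\<in>(#) y ` List.shuffles (x # xs) ys. G zs)"
    unfolding List.shuffles.simps by (rule sum.union_disjoint) (use 3(3) in auto)
  with 3 show ?case
    by (simp add: sum.reindex inj_on_def)
qed auto

text \<open>The word formed by the inverse of \<sigma> lists the elements x in the order of the
  values \<sigma> x. Hence \<sigma> is increasing on an interval exactly when the letters from it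
  occur in their natural order.\<close>

lemma strict_mono_on_inv_iff_filter:
  fixes a b :: nat
  assumes \<sigma>: "\<sigma> permutes {1..n}" and ab: "1 \<le> a" "b \<le> n"
  shows "strict_mono_on {a..b} \<sigma> \<longleftrightarrow>
    filter (\<lambda>x. x \<in> {a..b}) (map (inv \<sigma>) [1..<n + 1]) = [a..<b + 1]"
proof -
  let ?zs = "map (inv \<sigma>) [1..<n + 1]"
  let ?f = "filter (\<lambda>x. x \<in> {a..b}) ?zs"
  have inv: "inv \<sigma> permutes {1..n}" using \<sigma> by (rule permutes_inv)
  have dist: "distinct ?f"
    using permutes_inj[OF inv] by (simp add: distinct_map inj_on_def)
  have "set ?zs = {1..n}"
    using permutes_image[OF inv] by (simp add: atLeastLessThanSuc_atLeastAtMost)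
  then have set: "set ?f = {a..b}" using ab by auto
  have zs: "sorted_wrt (\<lambda>x y. \<sigma> x < \<sigma> y) ?zs"
    using \<sigma> by (simp add: sorted_wrt_map permutes_inverses[OF \<sigma>])
  from zs have key: "sorted_wrt (\<lambda>x y. \<sigma> x < \<sigma> y) ?f" by (rule sorted_wrt_filter)
  show ?thesis
  proof
    assume mono: "strict_mono_on {a..b} \<sigma>"
    have "sorted_wrt (<) ?f"
    proof (rule sorted_wrt_mono_rel[OF _ key])
      fix x y assume "x \<in> set ?f" "y \<in> set ?f" "\<sigma> x < \<sigma> y"
      then show "x < y"
        using strict_mono_on_less[OF mono, of x y] set by auto
    qed
    then show "?f = [a..<b + 1]"
      by (rule strict_sorted_equal[symmetric, OF _ sorted_wrt_upt]) (use set in auto)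
  next
    assume f: "?f = [a..<b + 1]"
    show "strict_mono_on {a..b} \<sigma>"
    proof (rule strict_mono_onI)
      fix r s assume rs: "r \<in> {a..b}" "s \<in> {a..b}" "r < s"
      have "sorted_wrt (\<lambda>x y. \<sigma> x < \<sigma> y) [a..<b + 1]" using key f by simp
      from sorted_wrt_nth_less[OF this, of "r - a" "s - a"] rs
      show "\<sigma> r < \<sigma> s" by simp
    qed
  qed
qed

text \<open>A word in distinct letters is a shuffle of two words precisely if its subwords on the
  two alphabets are these words. This turns the two monotonicity conditions into membership in
  \<open>List.shuffles\<close>.\<close>

lemma bij_betw_shuffles:
  "bij_betw (\<lambda>\<sigma>. map (inv \<sigma>) [1..<p + q + 1]) (shuffles p q)
     (List.shuffles [1..<p + 1] [p + 1..<p + q + 1])"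
proof -
  let ?F = "\<lambda>\<sigma>. map (inv \<sigma>) [1..<p + q + 1]"
  let ?A = "[1..<p + 1]" and ?B = "[p + 1..<p + q + 1]"
  have AB: "set ?A \<inter> set ?B = {}" by auto
  have filters: "filter (\<lambda>x. x \<in> {1..p}) zs = filter (\<lambda>x. x \<in> set ?A) zs"
    "filter (\<lambda>x. x \<in> {p+1..p+q}) zs = filter (\<lambda>x. x \<notin> set ?A) zs"
    if "set zs = {1..p + q}" for zs
    using that by (auto intro!: filter_cong)
  show ?thesis
  proof (rule bij_betwI')
    fix \<sigma> \<tau> assume "\<sigma> \<in> shuffles p q" "\<tau> \<in> shuffles p q"
    then have \<sigma>: "\<sigma> permutes {1..p+q}" and \<tau>: "\<tau> permutes {1..p+q}"
      by (auto simp: shuffles_def)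
    show "(?F \<sigma> = ?F \<tau>) = (\<sigma> = \<tau>)"
    proof
      assume "?F \<sigma> = ?F \<tau>"
      then have "inv \<sigma> i = inv \<tau> i" if "i \<in> {1..p+q}" for i
        using that by (auto simp: map_eq_conv)
      moreover have "inv \<sigma> i = inv \<tau> i" if "i \<notin> {1..p+q}" for i
        using permutes_not_in[OF permutes_inv[OF \<sigma>] that] permutes_not_in[OF permutes_inv[OF \<tau>] that]
        by simp
      ultimately have "inv \<sigma> = inv \<tau>" by blast
      then show "\<sigma> = \<tau>"
        using permutes_inv_inv[OF \<sigma>] permutes_inv_inv[OF \<tau>] by metis
    qed simp
  next
    fix \<sigma> assume "\<sigma> \<in> shuffles p q"
    then have \<sigma>: "\<sigma> permutes {1..p+q}"
      and m: "strict_mono_on {1..p} \<sigma>" "strict_mono_on {p+1..p+q} \<sigma>"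
      by (auto simp: shuffles_def)
    have s: "set (?F \<sigma>) = {1..p+q}"
      using permutes_image[OF permutes_inv[OF \<sigma>]] by (simp add: atLeastLessThanSuc_atLeastAtMost)
    have A: "filter (\<lambda>x. x \<in> set ?A) (?F \<sigma>) = ?A"
      unfolding filters(1)[OF s, symmetric]
      by (rule iffD1[OF strict_mono_on_inv_iff_filter[OF \<sigma>]]) (use m in \<open>simp_all\<close>)
    have B: "filter (\<lambda>x. x \<notin> set ?A) (?F \<sigma>) = ?B"
      unfolding filters(2)[OF s, symmetric]
      by (rule iffD1[OF strict_mono_on_inv_iff_filter[OF \<sigma>]]) (use m in \<open>simp_all\<close>)
    show "?F \<sigma> \<in> List.shuffles ?A ?B"
      using partition_in_shuffles[of "?F \<sigma>" "\<lambda>x. x \<in> set ?A"] unfolding A B .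
  next
    fix zs assume zs: "zs \<in> List.shuffles ?A ?B"
    have len: "length zs = p + q" using length_shuffles[OF zs] by simp
    have s: "set zs = {1..p+q}"
      unfolding set_shuffles[OF zs] set_upt set_eq_iff Un_iff atLeastLessThan_iff atLeastAtMost_iff
      by linarith
    have dist: "distinct zs" by (rule distinct_disjoint_shuffles[OF _ _ AB zs]) auto
    \<comment> \<open>The permutation read off the word, position i carrying the letter
      \<open>\<rho> i\<close>; outside 1..p+q it is the identity, as \<open>permutes\<close>
      demands. The shuffle sought is its inverse.\<close>
    define \<rho> where "\<rho> i = (if i \<in> {1..p+q} then zs ! (i - 1) else i)" for i
    have "bij_betw \<rho> {1..p+q} {1..p+q}"
    proof -
      have "bij_betw (\<lambda>i. i - 1) {1..p+q} {..<p+q}"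
        by (rule bij_betwI[where g = Suc]) auto
      from bij_betw_trans[OF this] bij_betw_nth[OF dist, of "{..<p+q}" "{1..p+q}"] len s
      have "bij_betw ((!) zs \<circ> (\<lambda>i. i - 1)) {1..p+q} {1..p+q}" by auto
      then show ?thesis
        by (rule iffD1[OF bij_betw_cong, rotated]) (auto simp: \<rho>_def)
    qed
    then have \<rho>: "\<rho> permutes {1..p+q}"
      by (rule bij_imp_permutes) (auto simp: \<rho>_def)
    define \<sigma> where "\<sigma> = inv \<rho>"
    have \<sigma>: "\<sigma> permutes {1..p+q}" unfolding \<sigma>_def using \<rho> by (rule permutes_inv)
    have "inv \<sigma> = \<rho>" unfolding \<sigma>_def by (rule permutes_inv_inv[OF \<rho>])
    then have F: "zs = ?F \<sigma>"
      by (intro nth_equalityI) (auto simp: len \<rho>_def)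
    have "filter (\<lambda>x. x \<in> {1..p}) (?F \<sigma>) = ?A" "filter (\<lambda>x. x \<in> {p+1..p+q}) (?F \<sigma>) = ?B"
      unfolding F[symmetric] filters[OF s] by (rule filter_shuffles_disjoint1[OF AB zs])+
    then have "\<sigma> \<in> shuffles p q"
      using \<sigma> strict_mono_on_inv_iff_filter[OF \<sigma>, of 1 p]
        strict_mono_on_inv_iff_filter[OF \<sigma>, of "p+1" "p+q"]
      by (simp add: shuffles_def)
    with F show "\<exists>\<sigma>\<in>shuffles p q. zs = ?F \<sigma>" by blast
  qed
qed

lemma finite_shuffle_permutations [simp]: "finite (shuffles p q)"
  by (rule finite_subset[OF _ finite_permutations[of "{1..p+q}"]]) (auto simp: shuffles_def)

text \<open>The bijection concerns words in the distinct numbers 1, ..., p + q; the letters of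
  \<open>xs @ ys\<close> are put in afterwards, so they may repeat. The shift by 1 translates
  numbers counted from 1 into list positions.\<close>

lemma sum_over_shuffles:
  assumes "length xs = p" "length ys = q"
  shows "(\<Sum>\<sigma>\<in>shuffles p q. G (map (\<lambda>i. (xs @ ys) ! (inv \<sigma> i - 1)) [1..<p + q + 1]))
    = shuffle_sum G xs ys"
proof -
  let ?y = "\<lambda>i. (xs @ ys) ! (i - 1)"
  have 1: "map ?y [1..<p+1] = xs"
    using assms by (intro nth_equalityI) (auto simp: nth_append)
  have 2: "map ?y [p+1..<p+q+1] = ys"
    using assms by (intro nth_equalityI) (auto simp: nth_append)
  have "(\<Sum>\<sigma>\<in>shuffles p q. G (map (\<lambda>i. ?y (inv \<sigma> i)) [1..<p + q + 1]))
    = (\<Sum>\<sigma>\<in>shuffles p q. G (map ?y (map (inv \<sigma>) [1..<p + q + 1])))"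
    by (simp add: comp_def)
  also have "\<dots> = (\<Sum>zs\<in>List.shuffles [1..<p + 1] [p + 1..<p + q + 1]. G (map ?y zs))"
    by (rule sum.reindex_bij_betw[OF bij_betw_shuffles])
  also have "\<dots> = shuffle_sum G (map ?y [1..<p+1]) (map ?y [p+1..<p+q+1])"
    unfolding shuffle_sum_map by (rule sum_shuffles_eq_shuffle_sum) auto
  finally show ?thesis unfolding 1 2 .
qed

text \<open>
  The first letter of a shuffle of \<open>x\<^sub>l \<dots> x\<^sub>1\<close> with \<open>x\<^sub>l\<^sub>+\<^sub>1 \<dots> x\<^sub>m\<close> is \<open>x\<^sub>l\<close> or \<open>x\<^sub>l\<^sub>+\<^sub>1\<close>, so the
  alternating sum over \<open>l\<close> telescopes.
\<close>

lemma shuffle_sum_telescope: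
  fixes G :: "'a list \<Rightarrow> 'b::ab_group_add"
  assumes "m = length xs" "m \<noteq> 0" "\<And>l. l \<in> {1..<m} \<Longrightarrow> shuffle_sum G (rev (take l xs)) (drop l xs) = 0"
  shows "G xs = (if even m then - G (rev xs) else G (rev xs))"
proof -
  \<comment> \<open>\<open>A l\<close> sums over the words that begin with x_l. They arise from
    splitting after x_l, where x_l heads the left word, and from splitting before it, where x_l
    heads the right word.\<close>
  define A where "A l = shuffle_sum (\<lambda>zs. G (xs ! (l - 1) # zs)) (rev (take (l - 1) xs)) (drop l xs)" for l
  have rec: "A (Suc l) = - A l" if "l \<in> {1..<m}" for l
  proof -
    have l: "l < length xs" "l - 1 < length xs" "Suc (l - 1) = l" using that assms(1) by auto
    have r: "rev (take l xs) = xs ! (l - 1) # rev (take (l - 1) xs)"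
      using take_Suc_conv_app_nth[OF l(2)] l(3) by simp
    have d: "drop l xs = xs ! l # drop (Suc l) xs" using l(1) by (rule Cons_nth_drop_Suc[symmetric])
    have "shuffle_sum G (rev (take l xs)) (drop l xs) = A l + A (Suc l)"
      by (simp add: r d A_def)
    with assms(3)[OF that] show ?thesis by (simp add: eq_neg_iff_add_eq_0 add.commute)
  qed
  have "A l = (if odd l then A 1 else - A 1)" if "l \<ge> 1" "l \<le> m" for l
    using that by (induction l rule: dec_induct) (auto simp: rec)
  from this[of m] have "A m = (if odd m then A 1 else - A 1)" using assms(2) by simp
  moreover have "A 1 = G xs" using assms by (cases xs) (auto simp: A_def)
  moreover have "A m = G (rev xs)"
  proof -
    have "xs = take (m - 1) xs @ [xs ! (m - 1)]"
      using take_Suc_conv_app_nth[of "m - 1" xs] assms(1,2) by simp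
    then have r: "rev xs = xs ! (m - 1) # rev (take (m - 1) xs)"
      by (metis rev_eq_Cons_iff rev_rev_ident)
    show ?thesis unfolding r using assms(1) by (simp add: A_def)
  qed
  ultimately show ?thesis by auto
qed

lemma shuffle_sum_single:
  "shuffle_sum G [t] cs = (\<Sum>i\<le>length cs. G (take i cs @ t # drop i cs))"
  by (induction cs arbitrary: G) (simp_all add: sum.atMost_Suc_shift del: sum.atMost_Suc)

section \<open>Parity\<close>

text \<open>List version of S_m: evaluating S_m p at \<open>us\<close> is evaluating p at
  \<open>suffix_sums us\<close>.\<close>

definition suffix_sums :: "'a::comm_monoid_add list \<Rightarrow> 'a list" where
  "suffix_sums us = map (\<lambda>i. sum_list (drop i us)) [0..<length us]"

definition difference_form :: "('a::ab_group_add list \<Rightarrow> 'b) \<Rightarrow> 'a list \<Rightarrow> 'b" where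
  "difference_form P ts = P (map (\<lambda>t. t - hd ts) (tl ts))"

lemma length_suffix_sums [simp]: "length (suffix_sums us) = length us"
  by (simp add: suffix_sums_def)

text \<open>
  Reversal of the arguments of \<open>P\<close> and of \<open>P \<circ> suffix_sums\<close> generate a dihedral group, in which
  the rotation of \<open>t\<^sub>0 t\<^sub>1 \<dots> t\<^sub>m\<close> appears composed with the sign change of all \<open>t\<^sub>i\<close>.
\<close>

lemma difference_form_rotate1:
  fixes P :: "'a::ab_group_add list \<Rightarrow> 'b::ab_group_add"
  assumes star: "\<And>xs ys. length xs + length ys = m \<Longrightarrow> xs \<noteq> [] \<Longrightarrow> ys \<noteq> [] \<Longrightarrow> shuffle_sum P xs ys = 0"
    and sh: "\<And>xs ys. length xs + length ys = m \<Longrightarrow> xs \<noteq> [] \<Longrightarrow> ys \<noteq> [] \<Longrightarrow>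
      shuffle_sum (\<lambda>us. P (suffix_sums us)) xs ys = 0"
    and odd: "\<And>xs. length xs = m \<Longrightarrow> P (map uminus xs) = - P xs"
    and ts: "length ts = Suc m" and m: "m \<noteq> 0"
  shows "difference_form P (rotate1 ts) = - difference_form P ts"
proof -
  have rev_P: "P xs = (if even m then - P (rev xs) else P (rev xs))" if "length xs = m" for xs
    by (rule shuffle_sum_telescope) (use that m in \<open>auto intro!: star\<close>)
  have rev_Q: "P (suffix_sums us) = (if even m then - P (suffix_sums (rev us)) else P (suffix_sums (rev us)))"
    if "length us = m" for us
    by (rule shuffle_sum_telescope[where G = "\<lambda>us. P (suffix_sums us)"])
      (use that m in \<open>auto intro!: sh\<close>)
  obtain t0 vs where ts': "ts = t0 # vs" "length vs = m" using ts by (cases ts) auto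
  \<comment> \<open>The value v_m = 0 lets the consecutive differences \<open>us\<close> telescope
    to v_i as suffix sums and to v_0 - v_i as prefix sums.\<close>
  define v where "v i = (if i < m then vs ! i - t0 else 0)" for i
  define us where "us = map (\<lambda>i. v i - v (Suc i)) [0..<m]"
  have len: "length us = m" by (simp add: us_def)
  have sum_us: "sum_list (map (\<lambda>i. v i - v (Suc i)) [a..<b]) = v a - v b" if "a \<le> b" for a b
    using that by (induction b rule: dec_induct) (simp_all add: upt_Suc_append)
  have suf: "sum_list (drop i us) = v i" if "i < m" for i
    using that sum_us[of i m] by (simp add: us_def drop_map v_def)
  have pre: "sum_list (take i us) = v 0 - v i" if "i \<le> m" for i
    using that sum_us[of 0 i] by (simp add: us_def take_map take_upt)
  have s1: "suffix_sums us = map (\<lambda>t. t - t0) vs"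
    by (rule nth_equalityI) (simp_all add: suffix_sums_def len suf ts'(2), simp add: v_def)
  have "rev (suffix_sums (rev us)) = map (\<lambda>i. v 0 - v i) [1..<m + 1]"
  proof (rule nth_equalityI)
    fix i assume "i < length (rev (suffix_sums (rev us)))"
    then have i: "i < m" by (simp add: len)
    then have "rev (suffix_sums (rev us)) ! i = sum_list (drop (m - Suc i) (rev us))"
      by (simp add: rev_nth len suffix_sums_def)
    also have "drop (m - Suc i) (rev us) = rev (take (Suc i) us)"
      using i by (simp add: rev_take len)
    also have "sum_list \<dots> = v 0 - v (Suc i)"
      using pre[of "Suc i"] i by simp
    finally show "rev (suffix_sums (rev us)) ! i = map (\<lambda>i. v 0 - v i) [1..<m + 1] ! i"
      using i by simp
  qed (simp add: len)
  \<comment> \<open>For i < m one has v_0 - v_i = -(t_(i+1) - t_1), while i = m gives v_0 = -(t_0 -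
    t_1): the base point has become t_1, and t_0 has moved to the end.\<close>
  also have "\<dots> = map uminus (map (\<lambda>t. t - vs ! 0) (tl vs @ [t0]))"
    by (rule nth_equalityI) (use m ts'(2) in \<open>auto simp: v_def nth_append nth_tl\<close>)
  finally have s2: "rev (suffix_sums (rev us)) = map uminus (map (\<lambda>t. t - vs ! 0) (tl vs @ [t0]))" .
  have "difference_form P ts = P (suffix_sums us)"
    by (simp add: difference_form_def ts' s1)
  \<comment> \<open>Both reversals carry the same sign (-1)^(m - 1), so their composition carries
    none.\<close>
  also have "\<dots> = P (rev (suffix_sums (rev us)))"
    using rev_Q[OF len] rev_P[of "suffix_sums (rev us)"] len by (auto split: if_splits)
  also have "\<dots> = - P (map (\<lambda>t. t - vs ! 0) (tl vs @ [t0]))"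
    unfolding s2 using m ts' by (intro odd) auto
  also have "\<dots> = - difference_form P (rotate1 ts)"
    using m ts' by (cases vs) (auto simp: difference_form_def)
  finally show ?thesis by simp
qed

lemma difference_form_eq_0:
  fixes P :: "'a::ab_group_add list \<Rightarrow> 'b::ab_group_add"
  assumes star: "\<And>xs ys. length xs + length ys = m \<Longrightarrow> xs \<noteq> [] \<Longrightarrow> ys \<noteq> [] \<Longrightarrow> shuffle_sum P xs ys = 0"
    and rot: "\<And>ts. length ts = Suc m \<Longrightarrow>
      difference_form P (rotate1 ts) = - difference_form P ts"
    and torsion: "\<And>x::'b. x + x = 0 \<Longrightarrow> x = 0"
    and m: "2 \<le> m" and ts: "length ts = Suc m"
  shows "difference_form P ts = 0"
proof -
  let ?F = "difference_form P"
  have rotate: "?F (rotate i ts) = (if even i then ?F ts else - ?F ts)" if "length ts = Suc m" for i ts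
    using that by (induction i) (simp_all add: rot)
  show ?thesis
  proof (cases "even m")
    case True
    then have "?F ts = - ?F ts" using rotate[OF ts, of "Suc m"] ts by (simp del: rotate_Suc)
    then have "?F ts + ?F ts = 0" by (simp add: eq_neg_iff_add_eq_0)
    then show ?thesis by (rule torsion)
  next
    case False
    text \<open>Insert \<open>t\<close> into all \<open>m\<close> gaps of a cyclic word \<open>c\<close> of length \<open>m\<close>; then compare with the
      same relation for \<open>c\<close> rotated by one step.\<close>
    obtain t c where tc: "ts = t # c" "length c = m" using ts by (cases ts) auto
    define a where "a i = ?F (t # rotate i c)" for i
    have gap: "(\<Sum>i<m. if even i then ?F (t # rotate (Suc i) c) else - ?F (t # rotate (Suc i) c)) = 0"
      if "length c = m" for c
    proof -
      obtain c0 cs where c: "c = c0 # cs" "m = Suc (length cs)" using \<open>length c = m\<close> m by (cases c) auto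
      \<comment> \<open>With c_0 as base point, shuffling t into the remaining letters inserts it
        into every gap of the cyclic word; as 2 \<le> m, these remaining letters form a nonempty
        word.\<close>
      have "0 = shuffle_sum P [t - c0] (map (\<lambda>x. x - c0) cs)"
        using c m by (intro star[symmetric]) auto
      also have "\<dots> = (\<Sum>i<m. ?F (c0 # take i cs @ t # drop i cs))"
        unfolding c(2) lessThan_Suc_atMost
        by (simp add: shuffle_sum_single difference_form_def take_map drop_map)
      also have "\<dots> = (\<Sum>i<m. if even i then - ?F (t # rotate (Suc i) c) else ?F (t # rotate (Suc i) c))"
      proof (rule sum.cong[OF refl])
        fix i assume "i \<in> {..<m}"
        then have i: "i \<le> length cs" using c by simp
        \<comment> \<open>Rotating i + 1 times brings t to the front, at the cost of the sign
          (-1)^(i + 1), and leaves c itself rotated by i + 1.\<close>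
        have r: "rotate (Suc i) (c0 # take i cs @ t # drop i cs) = t # rotate (Suc i) c"
        proof -
          have "rotate (Suc i) ((c0 # take i cs) @ (t # drop i cs)) = (t # drop i cs) @ (c0 # take i cs)"
            using i rotate_append[of "c0 # take i cs" "t # drop i cs"] by (simp del: rotate_Suc)
          moreover have "rotate (Suc i) ((c0 # take i cs) @ drop i cs) = drop i cs @ (c0 # take i cs)"
            using i rotate_append[of "c0 # take i cs" "drop i cs"] by (simp del: rotate_Suc)
          ultimately show ?thesis by (simp add: c del: rotate_Suc)
        qed
        have "length (c0 # take i cs @ t # drop i cs) = Suc m" using c i by simp
        from rotate[OF this, of "Suc i"]
        show "?F (c0 # take i cs @ t # drop i cs)
            = (if even i then - ?F (t # rotate (Suc i) c) else ?F (t # rotate (Suc i) c))"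
          unfolding r by auto
      qed
      also have "\<dots> = - (\<Sum>i<m. if even i then ?F (t # rotate (Suc i) c) else - ?F (t # rotate (Suc i) c))"
        unfolding sum_negf[symmetric] by (intro sum.cong) auto
      finally show ?thesis by simp
    qed
    obtain n where n: "m = Suc n" "even n" using False by (cases m) auto
    have m_n: "(\<Sum>i<n. if even i then a (Suc i) else - a (Suc i)) + a m = 0"
      using gap[OF tc(2)] unfolding a_def n(1) by (simp add: n(2) del: rotate_Suc)
    \<comment> \<open>Rotating by n = m - 1 undoes one step, so the relation for
      \<open>rotate n c\<close> starts at a_0 instead of a_1. The common terms a_1, ..., a_n have
      opposite signs in the two relations, which leaves a_0 + a_m = 0; a full turn gives a_m =
      a_0.\<close>
    have "rotate (Suc i) (rotate n c) = rotate i c" for i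
      using rotate_conv_mod[of "i + m" c] rotate_conv_mod[of i c] tc(2) n(1)
      by (simp add: rotate_rotate del: rotate_Suc) (metis mod_add_self2 add_Suc_right)
    then have "(\<Sum>i<Suc n. if even i then a i else - a i) = 0"
      using gap[of "rotate n c"] tc(2) unfolding a_def n(1)[symmetric] by (simp only: length_rotate)
    then have "a 0 + (\<Sum>i<n. if odd i then a (Suc i) else - a (Suc i)) = 0"
      by (simp add: sum.lessThan_Suc_shift del: sum.lessThan_Suc)
    also have "(\<Sum>i<n. if odd i then a (Suc i) else - a (Suc i))
        = - (\<Sum>i<n. if even i then a (Suc i) else - a (Suc i))"
      unfolding sum_negf[symmetric] by (intro sum.cong) auto
    also have "\<dots> = a m" using m_n by (simp add: neg_eq_iff_add_eq_0)
    also have "a m = a 0" using tc(2) by (simp add: a_def)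
    finally have "a 0 + a 0 = 0" .
    then have "a 0 = 0" by (rule torsion)
    then show ?thesis by (simp add: a_def tc)
  qed
qed

section \<open>Vanishing of the double shuffle space in odd degree\<close>

lemma poly_subst_T_star:
  "poly_subst f (T_star m l p) = (\<Sum>\<sigma>\<in>shuffles l (m - l). poly_subst (\<lambda>i. f (inv \<sigma> i)) p)"
  by (simp add: T_star_def T_perm_def poly_subst_sum poly_subst_poly_subst)

lemma poly_subst_T_sh:
  "poly_subst f (T_sh m l p) = (\<Sum>\<sigma>\<in>shuffles l (m - l). poly_subst (\<lambda>i. \<Sum>j = i..m. f (inv \<sigma> j)) p)"
  by (simp add: T_sh_def poly_subst_T_star S_map_def poly_subst_poly_subst poly_subst_sum)

lemma Dsh_eq_0_if_odd:
  fixes p :: "'k::field_char_0 mpol"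
  assumes m: "2 \<le> m" and p: "p \<in> Dsh m" and wt: "p \<in> polys_wt m k" and odd: "odd (k + m)"
  shows "p = 0"
proof -
  have polys: "p \<in> polys m" using p by (simp add: Dsh_def)
  define P where "P xs = poly_subst (\<lambda>i. xs ! (i - 1)) p" for xs
  have star: "shuffle_sum P xs ys = 0"
    if len: "length xs + length ys = m" "xs \<noteq> []" "ys \<noteq> []" for xs ys
  proof -
    let ?l = "length xs" and ?y = "\<lambda>i. (xs @ ys) ! (i - 1)"
    have "1 \<le> ?l" "1 \<le> length ys" using len by (simp_all add: Suc_le_eq)
    then have l: "?l \<in> {1..m - 1}" "m - ?l = length ys" "?l + length ys = m"
      using len(1) by auto
    have "shuffle_sum P xs ys
        = (\<Sum>\<sigma>\<in>shuffles ?l (m - ?l). P (map (\<lambda>i. ?y (inv \<sigma> i)) [1..<m + 1]))"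
      using sum_over_shuffles[of xs ?l ys "m - ?l" P] l by simp
    also have "\<dots> = poly_subst ?y (T_star m ?l p)"
      unfolding poly_subst_T_star P_def by (intro sum.cong refl poly_subst_cong[OF polys]) auto
    also have "\<dots> = 0" using p l(1) by (simp add: Dsh_def)
    finally show ?thesis .
  qed
  have sh: "shuffle_sum (\<lambda>us. P (suffix_sums us)) xs ys = 0"
    if len: "length xs + length ys = m" "xs \<noteq> []" "ys \<noteq> []" for xs ys
  proof -
    let ?l = "length xs" and ?y = "\<lambda>i. (xs @ ys) ! (i - 1)"
    have "1 \<le> ?l" "1 \<le> length ys" using len by (simp_all add: Suc_le_eq)
    then have l: "?l \<in> {1..m - 1}" "m - ?l = length ys" "?l + length ys = m"
      using len(1) by auto
    have "suffix_sums (map h [1..<m + 1]) ! (i - 1) = (\<Sum>j = i..m. h j)"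
      if "i \<in> {1..m}" for h :: "nat \<Rightarrow> 'k mpol" and i
      using that
      by (cases i) (auto simp: suffix_sums_def drop_map drop_upt interv_sum_list_conv_sum_set_nat
          atLeastLessThanSuc_atLeastAtMost)
    then have P: "P (suffix_sums (map h [1..<m + 1])) = poly_subst (\<lambda>i. \<Sum>j = i..m. h j) p" for h
      unfolding P_def by (intro poly_subst_cong[OF polys])
    have "shuffle_sum (\<lambda>us. P (suffix_sums us)) xs ys
        = (\<Sum>\<sigma>\<in>shuffles ?l (m - ?l). P (suffix_sums (map (\<lambda>i. ?y (inv \<sigma> i)) [1..<m + 1])))"
      using sum_over_shuffles[of xs ?l ys "m - ?l" "\<lambda>us. P (suffix_sums us)"] l by simp
    also have "\<dots> = poly_subst ?y (T_sh m ?l p)"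
      unfolding poly_subst_T_sh P ..
    also have "\<dots> = 0" using p l(1) by (simp add: Dsh_def)
    finally show ?thesis .
  qed
  have neg: "P (map uminus xs) = - P xs" if "length xs = m" for xs
  proof -
    have "P (map uminus xs) = poly_subst (\<lambda>i. - (xs ! (i - 1))) p"
      unfolding P_def by (rule poly_subst_cong[OF polys]) (use that in auto)
    also have "\<dots> = - P xs"
      using poly_subst_uminus_args[OF wt] odd by (simp add: P_def)
    finally show ?thesis .
  qed
  have rot: "difference_form P (rotate1 ts) = - difference_form P ts"
    if "length ts = Suc m" for ts
    by (rule difference_form_rotate1[of m]) (use that m star sh neg in auto)
  have torsion: "x = 0" if "x + x = 0" for x :: "'k mpol"
  proof (rule poly_mapping_eqI)
    fix a
    have "Poly_Mapping.lookup (x + x) a = 0" using that by simp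
    then have "2 * Poly_Mapping.lookup x a = 0" unfolding lookup_add mult_2 .
    then show "Poly_Mapping.lookup x a = Poly_Mapping.lookup 0 a" by simp
  qed
  \<comment> \<open>At base point 0, with the variables themselves as arguments, the difference form
    is p.\<close>
  have "difference_form P (0 # map X [1..<m + 1]) = 0"
    by (rule difference_form_eq_0[of m]) (use star rot torsion m in auto)
  also have "difference_form P (0 # map X [1..<m + 1]) = P (map X [1..<m + 1])"
    by (simp add: difference_form_def comp_def)
  also have "\<dots> = poly_subst X p"
    unfolding P_def by (rule poly_subst_cong[OF polys]) auto
  finally show ?thesis by (simp add: poly_subst_id)
qed

section \<open>The pairing of symbols and polynomials\<close>

text \<open>The exponent of the monomial that \<open>h_map\<close> matches with I(n); x_1 belongs to
  the last index.\<close>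

definition expo :: "nat list \<Rightarrow> nat \<Rightarrow>\<^sub>0 nat" where
  "expo n = (\<Sum>i = 1..length n. Poly_Mapping.single i (n ! (length n - i) - 1))"

lemma lookup_expo:
  "Poly_Mapping.lookup (expo n) i = (if i \<in> {1..length n} then n ! (length n - i) - 1 else 0)"
  unfolding expo_def by (subst lookup_sum_single) auto

lemma keys_expo: "Poly_Mapping.keys (expo n) \<subseteq> {1..length n}"
  by (auto simp: in_keys_iff lookup_expo split: if_splits)

lemma inj_on_expo: "inj_on expo (indices m)"
proof (rule inj_onI)
  fix n n' assume n: "n \<in> indices m" and n': "n' \<in> indices m" and eq: "expo n = expo n'"
  show "n = n'"
  proof (rule nth_equalityI)
    show "length n = length n'" using n n' by (simp add: indices_def)
    fix i assume i: "i < length n"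
    then have "Poly_Mapping.lookup (expo n) (m - i) = Poly_Mapping.lookup (expo n') (m - i)"
      by (simp add: eq)
    moreover have "1 \<le> n ! i" "1 \<le> n' ! i" using i n n' by (auto simp: indices_def)
    moreover have "length n = m" "length n' = m" using n n' by (auto simp: indices_def)
    ultimately show "n ! i = n' ! i"
      using i by (simp add: lookup_expo split: if_splits)
  qed
qed

lemma expo_surj:
  assumes "Poly_Mapping.keys a \<subseteq> {1..m}"
  obtains n where "n \<in> indices m" "expo n = a"
proof
  let ?n = "map (\<lambda>i. Poly_Mapping.lookup a (m - i) + 1) [0..<m]"
  show "?n \<in> indices m" by (auto simp: indices_def)
  show "expo ?n = a"
    by (rule poly_mapping_eqI) (use assms in \<open>auto simp: lookup_expo in_keys_iff subset_iff\<close>)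
qed

lemma mdeg_expo:
  assumes "n \<in> indices m"
  shows "mdeg (expo n) + m = sum_list n"
proof -
  have pos: "1 \<le> n ! i" if "i < m" for i
    using assms that by (auto simp: indices_def)
  have len: "length n = m" using assms by (simp add: indices_def)
  have "mdeg (expo n) + m = (\<Sum>i = 1..m. n ! (m - i) - 1) + (\<Sum>i = 1..m. 1)"
    using mdeg_superset[OF _ keys_expo, of n] by (simp add: lookup_expo len)
  also have "\<dots> = (\<Sum>i = 1..m. n ! (m - i))"
    unfolding sum.distrib[symmetric]
  proof (rule sum.cong[OF refl])
    fix i assume "i \<in> {1..m}"
    then show "n ! (m - i) - 1 + 1 = n ! (m - i)" using pos[of "m - i"] by simp
  qed
  also have "\<dots> = sum_list n"
    using sum.nat_diff_reindex[of "(!) n" m]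
    by (simp add: sum.atLeast1_atMost_eq sum_list_sum_nth len atLeast0LessThan)
  finally show ?thesis .
qed

lemma finite_indices_wt: "finite {n \<in> indices m. sum_list n = k}"
proof (rule finite_subset)
  show "{n \<in> indices m. sum_list n = k} \<subseteq> {n. set n \<subseteq> {..k} \<and> length n = m}"
    by (auto simp: indices_def dest: member_le_sum_list)
qed (simp add: finite_lists_length_eq)

text \<open>Pairing with a symbol of depth m inverts \<open>h_map\<close>. Symbols of another depth
  are sent to 0, so that relations of all depths can be tested at once.\<close>

definition pair :: "nat \<Rightarrow> 'k::field symb \<Rightarrow> 'k mpol \<Rightarrow> 'k" where
  "pair m w p = (\<Sum>n\<in>Poly_Mapping.keys w.
     if n \<in> indices m then Poly_Mapping.lookup w n * Poly_Mapping.lookup p (expo n) else 0)"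

lemma pair_superset:
  assumes "finite A" "Poly_Mapping.keys w \<subseteq> A"
  shows "pair m w p = (\<Sum>n\<in>A.
    if n \<in> indices m then Poly_Mapping.lookup w n * Poly_Mapping.lookup p (expo n) else 0)"
  unfolding pair_def
  by (rule sum.mono_neutral_left) (use assms in \<open>auto simp: in_keys_iff\<close>)

lemma pair_add: "pair m (v + w) p = pair m v p + pair m w p"
proof -
  let ?A = "Poly_Mapping.keys v \<union> Poly_Mapping.keys w"
  have "Poly_Mapping.keys (v + w) \<subseteq> ?A" by (rule keys_add)
  then show ?thesis
    by (auto simp: pair_superset[of ?A] lookup_add distrib_right sum.distrib[symmetric] intro!: sum.cong)
qed

lemma pair_pscale: "pair m (pscale c w) p = c * pair m w p"
proof -
  have "Poly_Mapping.keys (pscale c w) \<subseteq> Poly_Mapping.keys w"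
    by (auto simp: in_keys_iff lookup_pscale)
  then show ?thesis
    by (auto simp: pair_superset[of "Poly_Mapping.keys w"] lookup_pscale sum_distrib_left mult.assoc
        intro!: sum.cong)
qed

lemma pair_0 [simp]: "pair m 0 p = 0" "pair m w 0 = 0"
  by (simp_all add: pair_def cong: if_cong)

lemma pair_sum: "pair m (\<Sum>i\<in>I. w i) p = (\<Sum>i\<in>I. pair m (w i) p)"
  by (induction I rule: infinite_finite_induct) (simp_all add: pair_add)

lemma pair_symb: "pair m (symb n) p = (if n \<in> indices m then Poly_Mapping.lookup p (expo n) else 0)"
  by (simp add: pair_def symb_def)

lemma pair_add_right: "pair m w (p + q) = pair m w p + pair m w q"
  unfolding pair_def sum.distrib[symmetric]
  by (intro sum.cong) (auto simp: lookup_add distrib_left)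

lemma pair_pscale_right: "pair m w (pscale c p) = c * pair m w p"
  unfolding pair_def sum_distrib_left
  by (intro sum.cong) (auto simp: lookup_pscale)

lemma pair_eq_0_on_span:
  assumes "w \<in> pm.span R" "\<And>r. r \<in> R \<Longrightarrow> pair m r p = 0"
  shows "pair m w p = 0"
  using assms(1)
  by (induction rule: pm.span_induct_alt) (simp_all add: pair_add pair_pscale assms(2))

section \<open>Homogeneity, and the coefficients of the generating series\<close>

definition homog :: "nat \<Rightarrow> 'k::field mpol \<Rightarrow> bool" where
  "homog d p \<longleftrightarrow> (\<forall>a\<in>Poly_Mapping.keys p. mdeg a = d)"

lemma homog_0 [simp]: "homog d 0"
  and homog_1 [simp]: "homog 0 1"
  and homog_X [simp]: "homog 1 (X i)"
  by (simp_all add: homog_def X_def mdeg_def)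

lemma homog_add: "homog d p \<Longrightarrow> homog d q \<Longrightarrow> homog d (p + q)"
  using keys_add[of p q] by (auto simp: homog_def)

lemma homog_uminus: "homog d p \<Longrightarrow> homog d (- p)"
  by (auto simp: homog_def in_keys_iff)

lemma homog_diff: "homog d p \<Longrightarrow> homog d q \<Longrightarrow> homog d (p - q)"
  using homog_add[OF _ homog_uminus, of d p q] by simp

lemma homog_sum: "(\<And>i. i \<in> I \<Longrightarrow> homog d (p i)) \<Longrightarrow> homog d (\<Sum>i\<in>I. p i)"
  by (induction I rule: infinite_finite_induct) (auto intro: homog_add)

lemma homog_mult: "homog d p \<Longrightarrow> homog e q \<Longrightarrow> homog (d + e) (p * q)"
  using keys_mult[of p q] by (fastforce simp: homog_def mdeg_add)

lemma homog_power: "homog 1 p \<Longrightarrow> homog n (p ^ n)"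
  by (induction n) (use homog_mult[of 1 p] in auto)

lemma homog_prod_power:
  assumes "finite I" "\<And>i. i \<in> I \<Longrightarrow> homog 1 (p i)"
  shows "homog (\<Sum>i\<in>I. e i) (\<Prod>i\<in>I. p i ^ e i)"
  using assms by (induction I) (auto intro!: homog_mult homog_power)

text \<open>The coefficient of I(n) in the series is the coefficient at a of the monomial
  \<open>expo n\<close> evaluated at the differences. Summation against the coefficients of p
  therefore evaluates p at the differences, x_j receiving the (m + 1 - j)-th because of the reversal
  in \<open>expo\<close>.\<close>

lemma
  fixes ts :: "'k::field mpol list"
  assumes ts: "length ts = Suc m" and hom: "\<And>i. i < m \<Longrightarrow> homog 1 (ts ! i - ts ! m)" and m: "1 \<le> m"
  shows colon_series_in_W: "colon_series ts a \<in> W_depth_wt m (mdeg a + m)"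
    and pair_colon_series: "p \<in> polys m \<Longrightarrow>
      pair m (colon_series ts a) p = Poly_Mapping.lookup (poly_subst (\<lambda>j. ts ! (m - j) - ts ! m) p) a"
proof -
  define c where "c n = Poly_Mapping.lookup (\<Prod>i<m. (ts ! i - ts ! m) ^ (n ! i - 1)) a" for n
  let ?g = "\<lambda>j. ts ! (m - j) - ts ! m"
  let ?N = "{n. n \<in> indices m \<and> c n \<noteq> 0}"
  have eq: "colon_series ts a = (\<Sum>n\<in>?N. pscale (c n) (symb n))"
    by (simp add: colon_series_def Let_def ts c_def)
  have c_expo: "c n = Poly_Mapping.lookup (monom_at ?g (expo n)) a" if "n \<in> indices m" for n
  proof -
    have len: "length n = m" using that by (simp add: indices_def)
    have "monom_at ?g (expo n) = (\<Prod>j = 1..m. ?g j ^ (n ! (m - j) - 1))"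
      using monom_at_superset[OF _ keys_expo, of n ?g] by (simp add: lookup_expo len)
    also have "\<dots> = (\<Prod>i<m. (ts ! i - ts ! m) ^ (n ! i - 1))"
      using prod.nat_diff_reindex[of "\<lambda>i. (ts ! i - ts ! m) ^ (n ! i - 1)" m]
      by (simp add: prod.atLeast1_atMost_eq)
    finally show ?thesis by (simp add: c_def)
  qed
  \<comment> \<open>Homogeneity confines the contributing n to a single weight. Their set is thus
    finite; a sum over an infinite set would be 0 by convention.\<close>
  have N_wt: "sum_list n = mdeg a + m" if "n \<in> ?N" for n
  proof -
    have n: "n \<in> indices m" and "c n \<noteq> 0" using that by auto
    then have "a \<in> Poly_Mapping.keys (\<Prod>i<m. (ts ! i - ts ! m) ^ (n ! i - 1))"
      by (simp add: c_def in_keys_iff)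
    moreover have "homog (\<Sum>i<m. n ! i - 1) (\<Prod>i<m. (ts ! i - ts ! m) ^ (n ! i - 1))"
      by (rule homog_prod_power) (use hom in auto)
    ultimately have "mdeg a = (\<Sum>i<m. n ! i - 1)" by (simp add: homog_def)
    then have "mdeg a + m = (\<Sum>i<m. n ! i - 1 + 1)" unfolding sum.distrib by simp
    also have "\<dots> = (\<Sum>i<m. n ! i)"
      using n by (intro sum.cong) (auto simp: indices_def all_set_conv_all_nth)
    also have "\<dots> = sum_list n"
      using n by (simp add: sum_list_sum_nth atLeast0LessThan indices_def)
    finally show ?thesis ..
  qed
  then have fin: "finite ?N"
    by (intro finite_subset[OF _ finite_indices_wt[of m "mdeg a + m"]]) auto
  have "Poly_Mapping.keys (colon_series ts a) \<subseteq> ?N"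
    unfolding eq by (rule order_trans[OF keys_sum]) (auto simp: symb_def pscale_single)
  then show "colon_series ts a \<in> W_depth_wt m (mdeg a + m)"
    using N_wt m by (force simp: W_depth_wt_def W_depth_def W_def indices_def subset_iff)
  show "pair m (colon_series ts a) p = Poly_Mapping.lookup (poly_subst ?g p) a"
    if p: "p \<in> polys m"
  proof -
    let ?K = "{n \<in> indices m. expo n \<in> Poly_Mapping.keys p}"
    have bij: "bij_betw expo ?K (Poly_Mapping.keys p)"
    proof (rule bij_betw_imageI)
      show "inj_on expo ?K" by (rule inj_on_subset[OF inj_on_expo]) auto
      show "expo ` ?K = Poly_Mapping.keys p"
      proof
        show "Poly_Mapping.keys p \<subseteq> expo ` ?K"
        proof
          fix b assume "b \<in> Poly_Mapping.keys p"
          moreover from this have "Poly_Mapping.keys b \<subseteq> {1..m}" using p by (auto simp: polys_def)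
          then obtain n where "n \<in> indices m" "expo n = b" by (rule expo_surj)
          ultimately show "b \<in> expo ` ?K" by auto
        qed
      qed auto
    qed
    have finK: "finite ?K" using bij_betw_finite[OF bij] by simp
    have "pair m (colon_series ts a) p = (\<Sum>n\<in>?N. c n * Poly_Mapping.lookup p (expo n))"
      unfolding eq pair_sum by (intro sum.cong) (auto simp: pair_pscale pair_symb)
    also have "\<dots> = (\<Sum>n\<in>?K. c n * Poly_Mapping.lookup p (expo n))"
      by (rule sum.mono_neutral_cong) (use fin finK in \<open>auto simp: in_keys_iff\<close>)
    also have "\<dots> = (\<Sum>n\<in>?K. Poly_Mapping.lookup p (expo n)
        * Poly_Mapping.lookup (monom_at ?g (expo n)) a)"
      by (intro sum.cong) (auto simp: c_expo)
    also have "\<dots> = (\<Sum>b\<in>Poly_Mapping.keys p. Poly_Mapping.lookup p b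
        * Poly_Mapping.lookup (monom_at ?g b) a)"
      by (rule sum.reindex_bij_betw[OF bij])
    also have "\<dots> = Poly_Mapping.lookup (poly_subst ?g p) a"
      by (simp add: poly_subst_superset[OF finite_keys subset_refl] lookup_sum lookup_pscale)
    finally show ?thesis .
  qed
qed

section \<open>The double shuffle space as an annihilator\<close>

text \<open>Compensates for the reversal in \<open>expo\<close>. Fixing everything outside 1..m
  makes it an involution of all indices.\<close>

definition rev_index :: "nat \<Rightarrow> nat \<Rightarrow> nat" where
  "rev_index m i = (if i \<in> {1..m} then m + 1 - i else i)"

lemma rev_index_rev_index [simp]: "rev_index m (rev_index m i) = i"
  by (auto simp: rev_index_def)

lemma rev_index_in: "rev_index m i \<in> {1..m} \<longleftrightarrow> i \<in> {1..m}"
  by (auto simp: rev_index_def)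

lemma rev_index_permutes: "rev_index m permutes {1..m}"
proof (rule bij_imp_permutes)
  show "bij_betw (rev_index m) {1..m} {1..m}"
    by (rule bij_betwI[where g = "rev_index m"]) (auto simp only: rev_index_in rev_index_rev_index)
  show "rev_index m i = i" if "i \<notin> {1..m}" for i
    unfolding rev_index_def using that by (rule if_not_P)
qed

text \<open>Reversing both positions and values keeps a permutation increasing on a block but
  reflects the block, so the two block lengths are swapped.\<close>

lemma rev_index_conj_shuffles:
  assumes \<sigma>: "\<sigma> \<in> shuffles p q"
  defines "r \<equiv> rev_index (p + q)"
  shows "r \<circ> \<sigma> \<circ> r \<in> shuffles q p"
proof -
  have perm: "\<sigma> permutes {1..p + q}" using \<sigma> by (simp add: shuffles_def)
  have "r \<circ> \<sigma> \<circ> r permutes {1..p + q}"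
    unfolding r_def by (intro permutes_compose perm rev_index_permutes)
  moreover have "strict_mono_on {a..b} (r \<circ> \<sigma> \<circ> r)"
    if ab: "1 \<le> a" "b \<le> p + q" "strict_mono_on {p + q + 1 - b..p + q + 1 - a} \<sigma>" for a b
  proof (rule strict_mono_onI)
    fix i j assume ij: "i \<in> {a..b}" "j \<in> {a..b}" "i < j"
    have r: "r i = p + q + 1 - i" "r j = p + q + 1 - j" using ij ab by (auto simp: r_def rev_index_def)
    have "\<sigma> (r j) < \<sigma> (r i)"
      by (rule strict_mono_onD[OF ab(3)]) (use ij ab r in auto)
    moreover have "\<sigma> (r i) \<in> {1..p + q}" "\<sigma> (r j) \<in> {1..p + q}"
      unfolding permutes_in_image[OF perm] using ij ab r by auto
    ultimately show "(r \<circ> \<sigma> \<circ> r) i < (r \<circ> \<sigma> \<circ> r) j"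
      by (auto simp: r_def rev_index_def)
  qed
  from this[of 1 q] this[of "q + 1" "q + p"] \<sigma>
  have "strict_mono_on {1..q} (r \<circ> \<sigma> \<circ> r)" "strict_mono_on {q + 1..q + p} (r \<circ> \<sigma> \<circ> r)"
    by (auto simp: shuffles_def)
  ultimately show ?thesis by (simp add: shuffles_def add.commute)
qed

lemma sum_shuffles_rev_index:
  fixes p q :: nat and G :: "(nat \<Rightarrow> nat) \<Rightarrow> 'b::comm_monoid_add"
  defines "r \<equiv> rev_index (p + q)"
  shows "(\<Sum>\<sigma>\<in>shuffles p q. G (r \<circ> inv \<sigma> \<circ> r)) = (\<Sum>\<tau>\<in>shuffles q p. G (inv \<tau>))"
proof -
  let ?c = "\<lambda>\<sigma>. r \<circ> \<sigma> \<circ> r"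
  have bij: "bij_betw ?c (shuffles p q) (shuffles q p)"
  proof (rule bij_betwI[where g = ?c])
    show "?c \<in> shuffles p q \<rightarrow> shuffles q p"
      using rev_index_conj_shuffles[of _ p q] by (auto simp: r_def)
    show "?c \<in> shuffles q p \<rightarrow> shuffles p q"
      using rev_index_conj_shuffles[of _ q p] by (auto simp: r_def add.commute)
  qed (auto simp: r_def)
  have "inv (?c \<sigma>) = r \<circ> inv \<sigma> \<circ> r" if "\<sigma> \<in> shuffles p q" for \<sigma>
  proof -
    have "bij \<sigma>" using that permutes_bij by (auto simp: shuffles_def)
    moreover have "bij r" unfolding r_def by (rule permutes_bij[OF rev_index_permutes])
    moreover have "inv r = r" by (rule inv_unique_comp) (auto simp: r_def)
    ultimately show ?thesis by (simp add: o_inv_distrib bij_comp o_assoc)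
  qed
  then have "(\<Sum>\<sigma>\<in>shuffles p q. G (r \<circ> inv \<sigma> \<circ> r)) = (\<Sum>\<sigma>\<in>shuffles p q. G (inv (?c \<sigma>)))"
    by simp
  also have "\<dots> = (\<Sum>\<tau>\<in>shuffles q p. G (inv \<tau>))"
    by (rule sum.reindex_bij_betw[OF bij])
  finally show ?thesis .
qed

section \<open>Pairing with the double shuffle relations\<close>

definition star_rel :: "nat \<Rightarrow> nat \<Rightarrow> (nat \<Rightarrow>\<^sub>0 nat) \<Rightarrow> 'k::field symb" where
  "star_rel p q a = (\<Sum>\<sigma>\<in>shuffles p q.
     colon_series (map (\<lambda>i. X (inv \<sigma> i)) [1..<p + q + 1] @ [X (p + q + 1)]) a)"

definition sh_rel :: "nat \<Rightarrow> nat \<Rightarrow> (nat \<Rightarrow>\<^sub>0 nat) \<Rightarrow> 'k::field symb" where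
  "sh_rel p q a = (\<Sum>\<sigma>\<in>shuffles p q. comma_series (map (\<lambda>i. X (inv \<sigma> i)) [1..<p + q + 1]) a)"

lemma pm_subspace_W_depth_wt: "pm.subspace (W_depth_wt m k)"
proof (rule pm.subspaceI)
  fix x y :: "'k::field symb" and c
  assume x: "x \<in> W_depth_wt m k"
  show "pscale c x \<in> W_depth_wt m k"
    using x by (auto simp: W_depth_wt_def W_depth_def W_def in_keys_iff lookup_pscale)
  assume y: "y \<in> W_depth_wt m k"
  show "x + y \<in> W_depth_wt m k"
    using x y keys_add[of x y] by (auto simp: W_depth_wt_def W_depth_def W_def)
qed (simp add: W_depth_wt_def W_depth_def W_def)

lemma partial_sum_nth:
  assumes "i \<le> m"
  shows "(map (\<lambda>i. sum_list (take i (map h [1..<m + 1]))) [1..<m + 1] @ [0]) ! i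
    = (if i < m then \<Sum>j = 1..i + 1. h j else (0::'a::comm_monoid_add))"
  using assms
  by (auto simp: nth_append take_map take_upt interv_sum_list_conv_sum_set_nat
      atLeastLessThanSuc_atLeastAtMost)

text \<open>\<open>pair_colon_series\<close> puts the letters of each shuffle in reversed order.
  Conjugation by \<open>rev_index\<close> restores the order and swaps the block lengths, hence
  \<open>T_star\<close> and \<open>T_sh\<close> appear with q. What remains outside is the
  substitution by the reversal, for the first family with the base point X (p + q + 1)
  subtracted.\<close>

lemma
  fixes f :: "'k::field mpol"
  assumes pq: "1 \<le> p" "1 \<le> q"
  shows star_rel_in_W: "(star_rel p q a :: 'k symb) \<in> W_depth_wt (p + q) (mdeg a + (p + q))"
    and sh_rel_in_W: "(sh_rel p q a :: 'k symb) \<in> W_depth_wt (p + q) (mdeg a + (p + q))"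
    and pair_star_rel: "f \<in> polys (p + q) \<Longrightarrow> pair (p + q) (star_rel p q a) f
      = Poly_Mapping.lookup (poly_subst (\<lambda>i. X (rev_index (p + q) i) - X (p + q + 1))
          (T_star (p + q) q f)) a"
    and pair_sh_rel: "f \<in> polys (p + q) \<Longrightarrow> pair (p + q) (sh_rel p q a) f
      = Poly_Mapping.lookup (poly_subst (\<lambda>i. X (rev_index (p + q) i)) (T_sh (p + q) q f)) a"
proof -
  define m where "m = p + q"
  let ?r = "rev_index m"
  let ?star = "\<lambda>\<sigma>. map (\<lambda>i. X (inv \<sigma> i)) [1..<m + 1] @ [X (m + 1) :: 'k mpol]"
  let ?sh = "\<lambda>\<sigma>. map (\<lambda>i. sum_list (take i (map (\<lambda>i. X (inv \<sigma> i)) [1..<m + 1]))) [1..<m + 1] @ [0 :: 'k mpol]"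
  have m: "1 \<le> m" using pq by (simp add: m_def)
  have star_nth: "?star \<sigma> ! i - ?star \<sigma> ! m = X (inv \<sigma> (i + 1)) - X (m + 1)" if "i < m" for i \<sigma>
    using that by (simp add: nth_append)
  have sh_nth: "?sh \<sigma> ! i - ?sh \<sigma> ! m = (\<Sum>j = 1..i + 1. X (inv \<sigma> j))" if "i < m" for i \<sigma>
    unfolding partial_sum_nth[OF less_imp_le[OF that]] partial_sum_nth[OF order_refl]
    using that by simp
  have comma: "comma_series (map (\<lambda>i. X (inv \<sigma> i)) [1..<m + 1]) = colon_series (?sh \<sigma>)" for \<sigma>
    by (simp add: comma_series_def fun_eq_iff)
  have star_len: "length (?star \<sigma>) = Suc m" and sh_len: "length (?sh \<sigma>) = Suc m" for \<sigma>
    by simp_all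
  have star_hom: "homog 1 (?star \<sigma> ! i - ?star \<sigma> ! m)" if "i < m" for i \<sigma>
    unfolding star_nth[OF that] by (intro homog_diff homog_X)
  have sh_hom: "homog 1 (?sh \<sigma> ! i - ?sh \<sigma> ! m)" if "i < m" for i \<sigma>
    unfolding sh_nth[OF that] by (intro homog_sum homog_X)
  show "(star_rel p q a :: 'k symb) \<in> W_depth_wt (p + q) (mdeg a + (p + q))"
    unfolding star_rel_def m_def[symmetric]
    by (intro pm.subspace_sum[OF pm_subspace_W_depth_wt] colon_series_in_W[OF star_len star_hom m])
  show "(sh_rel p q a :: 'k symb) \<in> W_depth_wt (p + q) (mdeg a + (p + q))"
    unfolding sh_rel_def m_def[symmetric] comma
    by (intro pm.subspace_sum[OF pm_subspace_W_depth_wt] colon_series_in_W[OF sh_len sh_hom m])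
  assume "f \<in> polys (p + q)"
  then have f: "f \<in> polys m" by (simp add: m_def)
  have q: "m - q = p" "q + p = m" by (simp_all add: m_def)
  have "pair m (star_rel p q a) f = (\<Sum>\<sigma>\<in>shuffles p q.
      Poly_Mapping.lookup (poly_subst (\<lambda>i. X (?r ((?r \<circ> inv \<sigma> \<circ> ?r) i)) - X (m + 1)) f) a)"
    unfolding star_rel_def m_def[symmetric] pair_sum
  proof (rule sum.cong[OF refl])
    fix \<sigma>
    have "pair m (colon_series (?star \<sigma>) a) f
        = Poly_Mapping.lookup (poly_subst (\<lambda>j. ?star \<sigma> ! (m - j) - ?star \<sigma> ! m) f) a"
      by (rule pair_colon_series[OF star_len star_hom m f])
    also have "poly_subst (\<lambda>j. ?star \<sigma> ! (m - j) - ?star \<sigma> ! m) f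
        = poly_subst (\<lambda>i. X (?r ((?r \<circ> inv \<sigma> \<circ> ?r) i)) - X (m + 1)) f"
    proof (rule poly_subst_cong[OF f])
      fix j assume "j \<in> {1..m}"
      then show "?star \<sigma> ! (m - j) - ?star \<sigma> ! m = X (?r ((?r \<circ> inv \<sigma> \<circ> ?r) j)) - X (m + 1)"
        by (subst star_nth) (auto simp: rev_index_def[of m j] Suc_diff_le)
    qed
    finally show "pair m (colon_series (?star \<sigma>) a) f = Poly_Mapping.lookup
        (poly_subst (\<lambda>i. X (?r ((?r \<circ> inv \<sigma> \<circ> ?r) i)) - X (m + 1)) f) a" .
  qed
  also have "\<dots> = (\<Sum>\<tau>\<in>shuffles q p.
      Poly_Mapping.lookup (poly_subst (\<lambda>i. X (?r (inv \<tau> i)) - X (m + 1)) f) a)"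
    unfolding m_def by (rule sum_shuffles_rev_index)
  also have "\<dots> = Poly_Mapping.lookup (poly_subst (\<lambda>i. X (?r i) - X (m + 1)) (T_star m q f)) a"
    unfolding poly_subst_T_star q lookup_sum ..
  finally show "pair (p + q) (star_rel p q a) f
      = Poly_Mapping.lookup (poly_subst (\<lambda>i. X (rev_index (p + q) i) - X (p + q + 1))
          (T_star (p + q) q f)) a"
    unfolding m_def .
  have "pair m (sh_rel p q a) f = (\<Sum>\<sigma>\<in>shuffles p q.
      Poly_Mapping.lookup (poly_subst (\<lambda>i. \<Sum>j = i..m. X (?r ((?r \<circ> inv \<sigma> \<circ> ?r) j))) f) a)"
    unfolding sh_rel_def m_def[symmetric] pair_sum comma
  proof (rule sum.cong[OF refl])
    fix \<sigma>
    have "pair m (colon_series (?sh \<sigma>) a) f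
        = Poly_Mapping.lookup (poly_subst (\<lambda>j. ?sh \<sigma> ! (m - j) - ?sh \<sigma> ! m) f) a"
      by (rule pair_colon_series[OF sh_len sh_hom m f])
    also have "poly_subst (\<lambda>j. ?sh \<sigma> ! (m - j) - ?sh \<sigma> ! m) f
        = poly_subst (\<lambda>i. \<Sum>j = i..m. X (?r ((?r \<circ> inv \<sigma> \<circ> ?r) j))) f"
    proof (rule poly_subst_cong[OF f])
      fix j assume j: "j \<in> {1..m}"
      \<comment> \<open>The reversal turns a sum of initial letters into a sum from j to m, the
        shape of \<open>S_map\<close>.\<close>
      have "?sh \<sigma> ! (m - j) - ?sh \<sigma> ! m = (\<Sum>i = 1..m - j + 1. X (inv \<sigma> i))"
        by (rule sh_nth) (use j in auto)
      also have "\<dots> = (\<Sum>i = j..m. X (inv \<sigma> (?r i)))"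
        by (rule sum.reindex_bij_witness[of _ ?r ?r]) (use j in \<open>auto simp: rev_index_def\<close>)
      finally show "?sh \<sigma> ! (m - j) - ?sh \<sigma> ! m
          = (\<Sum>j = j..m. X (?r ((?r \<circ> inv \<sigma> \<circ> ?r) j)))"
        by simp
    qed
    finally show "pair m (colon_series (?sh \<sigma>) a) f = Poly_Mapping.lookup
        (poly_subst (\<lambda>i. \<Sum>j = i..m. X (?r ((?r \<circ> inv \<sigma> \<circ> ?r) j))) f) a" .
  qed
  also have "\<dots> = (\<Sum>\<tau>\<in>shuffles q p.
      Poly_Mapping.lookup (poly_subst (\<lambda>i. \<Sum>j = i..m. X (?r (inv \<tau> j))) f) a)"
    unfolding m_def by (rule sum_shuffles_rev_index)
  also have "\<dots> = Poly_Mapping.lookup (poly_subst (\<lambda>i. X (?r i)) (T_sh m q f)) a"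
    unfolding poly_subst_T_sh q lookup_sum ..
  finally show "pair (p + q) (sh_rel p q a) f
      = Poly_Mapping.lookup (poly_subst (\<lambda>i. X (rev_index (p + q) i)) (T_sh (p + q) q f)) a"
    unfolding m_def .
qed

lemma Dsh_iff_pair:
  fixes f :: "'k::field mpol"
  assumes f: "f \<in> polys m"
  shows "f \<in> Dsh m \<longleftrightarrow> (\<forall>p q a. 1 \<le> p \<longrightarrow> 1 \<le> q \<longrightarrow> p + q = m \<longrightarrow>
    pair m (star_rel p q a) f = 0 \<and> pair m (sh_rel p q a) f = 0)" (is "_ \<longleftrightarrow> ?R")
proof
  assume D: "f \<in> Dsh m"
  show ?R
  proof (intro allI impI)
    fix p q a assume pq: "1 \<le> p" "1 \<le> q" "p + q = m"
    then have "q \<in> {1..m - 1}" by auto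
    then have "T_star m q f = 0" "T_sh m q f = 0" using D by (auto simp: Dsh_def)
    then show "pair m (star_rel p q a) f = 0 \<and> pair m (sh_rel p q a) f = 0"
      using pair_star_rel[OF pq(1,2), of f a] pair_sh_rel[OF pq(1,2), of f a] f pq(3) by simp
  qed
next
  assume R: ?R
  let ?r = "rev_index m"
  have "T_star m q f = 0 \<and> T_sh m q f = 0" if "q \<in> {1..m - 1}" for q
  proof
    define p where "p = m - q"
    have pq: "1 \<le> p" "1 \<le> q" "p + q = m" using that by (auto simp: p_def)
    let ?s = "\<lambda>i. X (?r i) - X (m + 1) :: 'k mpol"
    \<comment> \<open>A left inverse of \<open>?s\<close> on the variables 1..m: it kills the base
      point and reverses once more.\<close>
    let ?t = "\<lambda>i. if i = m + 1 then 0 else X (?r i) :: 'k mpol"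
    have "poly_subst ?s (T_star m q f) = 0"
      using R pq pair_star_rel[OF pq(1,2), of f] f by (intro poly_mapping_eqI) auto
    then have "0 = poly_subst ?t (poly_subst ?s (T_star m q f))" by simp
    also have "\<dots> = (\<Sum>\<sigma>\<in>shuffles q (m - q). poly_subst (\<lambda>i. poly_subst ?t (?s (inv \<sigma> i))) f)"
      unfolding poly_subst_T_star poly_subst_sum poly_subst_poly_subst ..
    also have "\<dots> = (\<Sum>\<sigma>\<in>shuffles q (m - q). poly_subst (\<lambda>i. X (inv \<sigma> i)) f)"
    proof (intro sum.cong refl poly_subst_cong[OF f])
      fix \<sigma> i assume \<sigma>: "\<sigma> \<in> shuffles q (m - q)" and i: "i \<in> {1..m}"
      have "\<sigma> permutes {1..m}" using \<sigma> pq by (simp add: shuffles_def p_def)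
      then have "inv \<sigma> i \<in> {1..m}" using i by (rule iffD2[OF permutes_in_image[OF permutes_inv]])
      then have "?r (inv \<sigma> i) \<in> {1..m}" by (simp only: rev_index_in)
      then show "poly_subst ?t (?s (inv \<sigma> i)) = X (inv \<sigma> i)"
        by (auto simp: poly_subst_diff)
    qed
    also have "\<dots> = T_star m q f" by (simp add: T_star_def T_perm_def)
    finally show "T_star m q f = 0" by simp
    have "poly_subst (\<lambda>i. X (?r i)) (T_sh m q f) = 0"
      using R pq pair_sh_rel[OF pq(1,2), of f] f by (intro poly_mapping_eqI) auto
    then have "0 = poly_subst (\<lambda>i. X (?r i)) (poly_subst (\<lambda>i. X (?r i)) (T_sh m q f))" by simp
    also have "\<dots> = T_sh m q f"
      by (simp add: poly_subst_poly_subst poly_subst_id)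
    finally show "T_sh m q f = 0" by simp
  qed
  then show "f \<in> Dsh m" using f by (simp add: Dsh_def)
qed

section \<open>Linear forms on finitely supported functions\<close>

lemma vector_space_pair_pscale:
  "vector_space_pair (pscale :: 'k::field \<Rightarrow> ('a \<Rightarrow>\<^sub>0 'k) \<Rightarrow> _) ((*) :: 'k \<Rightarrow> 'k \<Rightarrow> 'k)"
  by unfold_locales (simp_all add: algebra_simps)

lemma linear_form_extend:
  fixes S :: "('a \<Rightarrow>\<^sub>0 'k::field) set"
  assumes S: "pm.subspace S"
    and add: "\<And>u v. u \<in> S \<Longrightarrow> v \<in> S \<Longrightarrow> \<phi> (u + v) = \<phi> u + \<phi> v"
    and scale: "\<And>c v. v \<in> S \<Longrightarrow> \<phi> (pscale c v) = c * \<phi> v"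
  obtains \<psi> where "Vector_Spaces.linear pscale (*) \<psi>" "\<And>v. v \<in> S \<Longrightarrow> \<psi> v = \<phi> v"
proof -
  obtain B where B: "B \<subseteq> S" "pm.independent B" "S \<subseteq> pm.span B"
    using pm.maximal_independent_subset by metis
  obtain \<psi> where \<psi>: "Vector_Spaces.linear pscale (*) \<psi>" "\<And>v. v \<in> B \<Longrightarrow> \<psi> v = \<phi> v"
    using vector_space_pair.linear_independent_extend[OF vector_space_pair_pscale B(2), of \<phi>] by metis
  have \<psi>_add: "\<psi> (u + v) = \<psi> u + \<psi> v" and \<psi>_scale: "\<psi> (pscale c v) = c * \<psi> v" for u v c
    using \<psi>(1) by (simp_all add: Vector_Spaces.linear_iff)
  have "0 \<in> S" using S by (rule pm.subspace_0)
  then have "\<phi> 0 = 0" using scale[of 0 0] by simp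
  moreover have "\<psi> 0 = 0" using \<psi>_scale[of 0 0] by simp
  ultimately have "pm.subspace {v \<in> S. \<psi> v = \<phi> v}"
    using S by (auto simp: pm.subspace_def \<psi>_add \<psi>_scale add scale)
  then have "pm.span B \<subseteq> {v \<in> S. \<psi> v = \<phi> v}"
    using B(1) \<psi>(2) by (intro pm.span_minimal) auto
  then show ?thesis using that[OF \<psi>(1)] B(3) by auto
qed

text \<open>A basis of the span of R stays independent when w is adjoined, so a form may be
  prescribed as 0 on the basis and 1 at w.\<close>

lemma separating_linear_form:
  fixes w :: "'a \<Rightarrow>\<^sub>0 'k::field"
  assumes w: "w \<notin> pm.span R"
  obtains \<psi> where "Vector_Spaces.linear pscale (*) \<psi>" "\<And>r. r \<in> R \<Longrightarrow> \<psi> r = (0::'k)" "\<psi> w = 1"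
proof -
  obtain B where B: "B \<subseteq> R" "pm.independent B" "R \<subseteq> pm.span B"
    using pm.maximal_independent_subset by metis
  have wB: "w \<notin> pm.span B" using w pm.span_mono[OF B(1)] by blast
  then have "pm.independent (insert w B)" using B(2) pm.independent_insert[of w B] by auto
  from vector_space_pair.linear_independent_extend[OF vector_space_pair_pscale this,
      of "\<lambda>v. if v = w then 1 else 0"]
  obtain \<psi> where \<psi>: "Vector_Spaces.linear pscale (*) \<psi>"
    "\<And>v. v \<in> insert w B \<Longrightarrow> \<psi> v = (if v = w then 1 else (0::'k))"
    by metis
  have zero: "\<psi> v = 0" if "v \<in> B" for v
    using that wB \<psi>(2)[of v] pm.span_base[of v B] by auto
  have lin: "\<psi> (u + v) = \<psi> u + \<psi> v" "\<psi> (pscale c v) = c * \<psi> v" for u v c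
    using \<psi>(1) by (simp_all add: Vector_Spaces.linear_iff)
  have "\<psi> 0 = 0" using lin(2)[of 0 0] by simp
  have "\<psi> v = 0" if "v \<in> pm.span B" for v
    using that by (induction rule: pm.span_induct_alt) (simp_all add: \<open>\<psi> 0 = 0\<close> lin zero)
  with B(3) \<psi> that show ?thesis by (metis insertI1 subsetD)
qed

text \<open>Projection onto the span of the basis vectors satisfying P. It gives the weight
  components of symbols and of polynomials alike.\<close>

definition part :: "('a \<Rightarrow> bool) \<Rightarrow> ('a \<Rightarrow>\<^sub>0 'k::field) \<Rightarrow> 'a \<Rightarrow>\<^sub>0 'k" where
  "part P p = (\<Sum>a\<in>{a \<in> Poly_Mapping.keys p. P a}. Poly_Mapping.single a (Poly_Mapping.lookup p a))"

lemma lookup_part: "Poly_Mapping.lookup (part P p) a = (if P a then Poly_Mapping.lookup p a else 0)"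
  by (auto simp: part_def lookup_sum lookup_single when_def sum.delta in_keys_iff)

lemma part_add: "part P (p + q) = part P p + part P q"
  by (rule poly_mapping_eqI) (simp add: lookup_part lookup_add)

lemma part_pscale: "part P (pscale c p) = pscale c (part P p)"
  by (rule poly_mapping_eqI) (simp add: lookup_part lookup_pscale)

lemma sum_parts:
  assumes "finite K" "\<And>a. a \<in> Poly_Mapping.keys p \<Longrightarrow> f a \<in> K"
  shows "(\<Sum>k\<in>K. part (\<lambda>a. f a = k) p) = p"
proof (rule poly_mapping_eqI)
  fix a
  have "Poly_Mapping.lookup (\<Sum>k\<in>K. part (\<lambda>a. f a = k) p) a
      = (if f a \<in> K then Poly_Mapping.lookup p a else 0)"
    using assms(1) by (simp add: lookup_sum lookup_part)
  then show "Poly_Mapping.lookup (\<Sum>k\<in>K. part (\<lambda>a. f a = k) p) a = Poly_Mapping.lookup p a"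
    using assms(2)[of a] by (auto simp: in_keys_iff)
qed

section \<open>Subspaces and their weight components\<close>

lemma pm_subspace_W: "pm.subspace W"
proof (rule pm.subspaceI)
  fix x y :: "'k::field symb" and c
  assume x: "x \<in> W"
  show "pscale c x \<in> W"
    using x by (auto simp: W_def in_keys_iff lookup_pscale)
  assume y: "y \<in> W"
  show "x + y \<in> W"
    using x y keys_add[of x y] by (auto simp: W_def)
qed (simp add: W_def)

lemma pm_subspace_W_depth: "pm.subspace (W_depth m)"
proof (rule pm.subspaceI)
  fix x y :: "'k::field symb" and c
  assume x: "x \<in> W_depth m"
  show "pscale c x \<in> W_depth m"
    using x by (auto simp: W_depth_def W_def in_keys_iff lookup_pscale)
  assume y: "y \<in> W_depth m"
  show "x + y \<in> W_depth m"
    using x y keys_add[of x y] by (auto simp: W_depth_def W_def)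
qed (simp add: W_depth_def W_def)

lemma W_depth_subset_W: "W_depth m \<subseteq> W"
  and W_depth_wt_subset: "W_depth_wt m k \<subseteq> W_depth m"
  by (auto simp: W_depth_def W_depth_wt_def)

lemma keys_W_depth: "w \<in> W_depth m \<Longrightarrow> n \<in> Poly_Mapping.keys w \<Longrightarrow> n \<in> indices m"
  by (auto simp: W_depth_def W_def indices_def)

lemma pm_subspace_polys: "pm.subspace (polys m)"
proof (rule pm.subspaceI)
  fix x y :: "'k::field mpol" and c
  assume x: "x \<in> polys m"
  show "pscale c x \<in> polys m"
    using x by (auto simp: polys_def in_keys_iff lookup_pscale)
  assume y: "y \<in> polys m"
  show "x + y \<in> polys m"
    using x y keys_add[of x y] by (auto simp: polys_def)
qed (simp add: polys_def)

lemma Dsh_subset_polys: "Dsh m \<subseteq> polys m"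
  by (auto simp: Dsh_def)

text \<open>\<open>Dsh_iff_pair\<close> describes Dsh_m as an annihilator, and the pairing is linear
  in the polynomial.\<close>

lemma pm_subspace_Dsh: "pm.subspace (Dsh m :: 'k::field mpol set)"
proof (rule pm.subspaceI)
  show "(0 :: 'k mpol) \<in> Dsh m"
    by (subst Dsh_iff_pair) (simp_all add: pm.subspace_0[OF pm_subspace_polys])
  fix x y :: "'k mpol" and c
  assume x: "x \<in> Dsh m"
  then have xp: "x \<in> polys m" using Dsh_subset_polys by blast
  show "pscale c x \<in> Dsh m"
    using x unfolding Dsh_iff_pair[OF xp] Dsh_iff_pair[OF pm.subspace_scale[OF pm_subspace_polys xp]]
    by (simp add: pair_pscale_right)
  assume y: "y \<in> Dsh m"
  then have yp: "y \<in> polys m" using Dsh_subset_polys by blast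
  show "x + y \<in> Dsh m"
    using x y
    unfolding Dsh_iff_pair[OF xp] Dsh_iff_pair[OF yp] Dsh_iff_pair[OF pm.subspace_add[OF pm_subspace_polys xp yp]]
    by (simp add: pair_add_right)
qed

lemma pair_conv_keys:
  "w \<in> W_depth m \<Longrightarrow> pair m w p
    = (\<Sum>n\<in>Poly_Mapping.keys w. Poly_Mapping.lookup w n * Poly_Mapping.lookup p (expo n))"
  unfolding pair_def by (rule sum.cong) (auto simp: keys_W_depth)

text \<open>By \<open>mdeg_expo\<close> the pairing is orthogonal between different weights, so
  against p only the weight k part of w counts.\<close>

lemma pair_part_symb:
  assumes w: "w \<in> W_depth m" and p: "p \<in> polys_wt m k"
  shows "pair m (part (\<lambda>n. sum_list n = k) w) p = pair m w p"
proof -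
  have "Poly_Mapping.keys (part (\<lambda>n. sum_list n = k) w) \<subseteq> Poly_Mapping.keys w"
    by (auto simp: in_keys_iff lookup_part split: if_splits)
  then have "pair m (part (\<lambda>n. sum_list n = k) w) p = (\<Sum>n\<in>Poly_Mapping.keys w.
      (if sum_list n = k then Poly_Mapping.lookup w n else 0) * Poly_Mapping.lookup p (expo n))"
    by (subst pair_superset[of "Poly_Mapping.keys w"])
      (auto simp: lookup_part keys_W_depth[OF w] intro!: sum.cong)
  also have "\<dots> = pair m w p"
    unfolding pair_conv_keys[OF w]
  proof (rule sum.cong[OF refl])
    fix n assume n: "n \<in> Poly_Mapping.keys w"
    have "expo n \<notin> Poly_Mapping.keys p" if "sum_list n \<noteq> k"
      using that p mdeg_expo[OF keys_W_depth[OF w n]] by (auto simp: polys_wt_def)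
    then have "Poly_Mapping.lookup p (expo n) = 0" if "sum_list n \<noteq> k"
      using that by (simp add: in_keys_iff)
    then show "(if sum_list n = k then Poly_Mapping.lookup w n else 0) * Poly_Mapping.lookup p (expo n)
        = Poly_Mapping.lookup w n * Poly_Mapping.lookup p (expo n)" by auto
  qed
  finally show ?thesis .
qed

lemma pair_part_poly:
  assumes w: "w \<in> W_depth_wt m j"
  shows "pair m w (part (\<lambda>a. mdeg a + m = k) p) = (if j = k then pair m w p else 0)"
proof -
  have w': "w \<in> W_depth m" using w W_depth_wt_subset by blast
  have "mdeg (expo n) + m = j" if "n \<in> Poly_Mapping.keys w" for n
    using mdeg_expo[OF keys_W_depth[OF w' that]] w that by (simp add: W_depth_wt_def)
  then show ?thesis
    by (auto simp: pair_conv_keys[OF w'] lookup_part intro!: sum.cong)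
qed

lemma star_rel_eq: "star_coeffs = {star_rel p q a | p q a. 1 \<le> p \<and> 1 \<le> q}"
  and sh_rel_eq: "sh_coeffs = {sh_rel p q a | p q a. 1 \<le> p \<and> 1 \<le> q}"
  by (simp_all add: star_coeffs_def star_rel_def sh_coeffs_def sh_rel_def)

text \<open>Each relation is homogeneous, so its pairing with a weight component of p is either its
  pairing with p or 0. This makes Dsh_m a graded subspace.\<close>

lemma part_in_Dsh:
  fixes p :: "'k::field mpol"
  assumes p: "p \<in> Dsh m"
  shows "part (\<lambda>a. mdeg a + m = k) p \<in> Dsh m \<inter> polys_wt m k"
proof -
  have pp: "p \<in> polys m" using p Dsh_subset_polys by blast
  then have part: "part (\<lambda>a. mdeg a + m = k) p \<in> polys_wt m k"
    by (auto simp: polys_wt_def polys_def in_keys_iff lookup_part split: if_splits)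
  then have pm: "part (\<lambda>a. mdeg a + m = k) p \<in> polys m" by (simp add: polys_wt_def)
  have "part (\<lambda>a. mdeg a + m = k) p \<in> Dsh m"
    unfolding Dsh_iff_pair[OF pm]
  proof (intro allI impI)
    fix r s a assume rs: "1 \<le> r" "1 \<le> s" "r + s = m"
    show "pair m (star_rel r s a) (part (\<lambda>a. mdeg a + m = k) p) = 0
        \<and> pair m (sh_rel r s a) (part (\<lambda>a. mdeg a + m = k) p) = 0"
      using p rs pair_part_poly[OF star_rel_in_W[OF rs(1,2), of a, unfolded rs(3)], of k p]
        pair_part_poly[OF sh_rel_in_W[OF rs(1,2), of a, unfolded rs(3)], of k p]
      unfolding Dsh_iff_pair[OF pp] by auto
  qed
  with part show ?thesis by blast
qed

text \<open>Biduality in one weight: a form that vanishes on R but not at w is given, on the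
  finitely many symbols of depth m and weight k, by a polynomial. It lies in Dsh_m because relations
  of weight k are killed by the form and those of other weights by orthogonality.\<close>

lemma Dsh_separates:
  fixes w :: "'k::field symb"
  assumes w: "w \<in> W_depth_wt m k" "w \<notin> pm.span R" and R: "star_coeffs \<union> sh_coeffs \<subseteq> R"
  obtains p where "p \<in> Dsh m" "p \<in> polys_wt m k" "pair m w p \<noteq> 0"
proof -
  obtain \<psi> where \<psi>: "Vector_Spaces.linear pscale (*) \<psi>" "\<And>r. r \<in> R \<Longrightarrow> \<psi> r = (0::'k)" "\<psi> w = 1"
    using separating_linear_form[OF w(2)] by metis
  have add: "\<psi> (u + v) = \<psi> u + \<psi> v" and scale: "\<psi> (pscale c v) = c * \<psi> v" for u v c
    using \<psi>(1) by (simp_all add: Vector_Spaces.linear_iff)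
  have \<psi>0: "\<psi> 0 = 0" using scale[of 0 0] by simp
  have \<psi>_sum: "\<psi> (sum f A) = (\<Sum>i\<in>A. \<psi> (f i))" for f :: "nat list \<Rightarrow> _" and A
    by (induction A rule: infinite_finite_induct) (simp_all add: add \<psi>0)
  let ?N = "{n \<in> indices m. sum_list n = k}"
  \<comment> \<open>The coefficients are the values of the form on the symbols of weight k; its
    values in other weights are discarded, which keeps the sum finite.\<close>
  define p where "p = (\<Sum>n\<in>?N. Poly_Mapping.single (expo n) (\<psi> (symb n)))"
  have lookup_p: "Poly_Mapping.lookup p (expo n) = (if sum_list n = k then \<psi> (symb n) else 0)"
    if n: "n \<in> indices m" for n
  proof -
    have "Poly_Mapping.lookup p (expo n) = (\<Sum>n'\<in>?N. if n' = n then \<psi> (symb n') else 0)"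
      unfolding p_def lookup_sum
      by (rule sum.cong) (auto simp: lookup_single when_def inj_on_eq_iff[OF inj_on_expo _ n])
    also have "\<dots> = (if n \<in> ?N then \<psi> (symb n) else 0)"
      by (rule sum.delta[OF finite_indices_wt])
    finally show ?thesis using n by simp
  qed
  have p_wt: "p \<in> polys_wt m k"
  proof -
    have "\<exists>n\<in>?N. a = expo n" if "a \<in> Poly_Mapping.keys p" for a
      using that keys_sum[of "\<lambda>n. Poly_Mapping.single (expo n) (\<psi> (symb n))" ?N]
      by (auto simp: p_def split: if_splits)
    then show ?thesis
      using keys_expo mdeg_expo by (fastforce simp: polys_wt_def polys_def indices_def)
  qed
  then have p_polys: "p \<in> polys m" by (simp add: polys_wt_def)
  have pair: "pair m v p = (if j = k then \<psi> v else 0)" if v: "v \<in> W_depth_wt m j" for v j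
  proof -
    have v': "v \<in> W_depth m" using v W_depth_wt_subset by blast
    have wt: "sum_list n = j" if "n \<in> Poly_Mapping.keys v" for n
      using v that by (simp add: W_depth_wt_def)
    have "pair m v p = (\<Sum>n\<in>Poly_Mapping.keys v.
        if j = k then Poly_Mapping.lookup v n * \<psi> (symb n) else 0)"
      unfolding pair_conv_keys[OF v']
      by (rule sum.cong) (auto simp: lookup_p keys_W_depth[OF v'] wt)
    also have "(\<Sum>n\<in>Poly_Mapping.keys v. Poly_Mapping.lookup v n * \<psi> (symb n)) = \<psi> v"
      using \<psi>_sum[of "\<lambda>n. pscale (Poly_Mapping.lookup v n) (symb n)" "Poly_Mapping.keys v"]
      by (simp add: symb_def poly_mapping_sum_singles scale)
    then have "(\<Sum>n\<in>Poly_Mapping.keys v. if j = k then Poly_Mapping.lookup v n * \<psi> (symb n) else 0)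
      = (if j = k then \<psi> v else 0)" by simp
    finally show ?thesis .
  qed
  have "p \<in> Dsh m"
    unfolding Dsh_iff_pair[OF p_polys]
  proof (intro allI impI)
    fix r s a assume rs: "1 \<le> r" "1 \<le> s" "r + s = m"
    have "(star_rel r s a :: 'k symb) \<in> star_coeffs" "(sh_rel r s a :: 'k symb) \<in> sh_coeffs"
      using rs(1,2) unfolding star_rel_eq sh_rel_eq by blast+
    then have "\<psi> (star_rel r s a) = 0" "\<psi> (sh_rel r s a) = 0" using R \<psi>(2) by auto
    then show "pair m (star_rel r s a) p = 0 \<and> pair m (sh_rel r s a) p = 0"
      using pair[OF star_rel_in_W[OF rs(1,2), of a, unfolded rs(3)]]
        pair[OF sh_rel_in_W[OF rs(1,2), of a, unfolded rs(3)]] by simp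
  qed
  with p_wt show ?thesis using that pair[OF w(1)] \<psi>(3) by simp
qed

section \<open>The relations\<close>

lemma W_R_eq_span: "W_R = pm.span (star_coeffs \<union> sh_coeffs \<union> {symb [2 * n] | n. 1 \<le> n})"
  unfolding W_R_def W_star_def W_sh_def W_1even_def pm.span_Un by fastforce

lemma pm_subspace_W_R: "pm.subspace W_R"
  unfolding W_R_eq_span by (rule pm.subspace_span)

text \<open>Generators of depth m are handled by \<open>Dsh_iff_pair\<close>; all others pair to 0
  for reasons of depth, among them the I(2n), since 2 \<le> m.\<close>

lemma pair_eq_0_on_W_R:
  fixes p :: "'k::field mpol"
  assumes m: "2 \<le> m" and w: "w \<in> W_R" and p: "p \<in> Dsh m"
  shows "pair m w p = 0"
  using w unfolding W_R_eq_span
proof (rule pair_eq_0_on_span)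
  have other: "pair m v p = 0" if "v \<in> W_depth m'" "m' \<noteq> m" for v :: "'k symb" and m'
    unfolding pair_def by (rule sum.neutral) (use that in \<open>auto dest: keys_W_depth simp: indices_def\<close>)
  have P: "p \<in> polys m" using p Dsh_subset_polys by blast
  have zero: "pair m (star_rel r s a) p = 0 \<and> pair m (sh_rel r s a) p = 0"
    if rs: "1 \<le> r" "1 \<le> s" for r s a
  proof (cases "r + s = m")
    case True
    then show ?thesis using p rs unfolding Dsh_iff_pair[OF P] by blast
  next
    case False
    then show ?thesis
      using star_rel_in_W[OF rs, of a] sh_rel_in_W[OF rs, of a] W_depth_wt_subset other by blast
  qed
  fix r :: "'k symb" assume "r \<in> star_coeffs \<union> sh_coeffs \<union> {symb [2 * n] | n. 1 \<le> n}"
  then show "pair m r p = 0"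
    using zero m unfolding star_rel_eq sh_rel_eq by (auto simp: pair_symb indices_def)
qed

text \<open>Separation by a polynomial is available in one weight at a time, so w is cut into weight
  components; the pairing of a component with a polynomial of the same weight is that of w
  itself.\<close>

lemma W_R_iff_pair:
  assumes m: "2 \<le> m" and w: "w \<in> W_depth m"
  shows "w \<in> W_R \<longleftrightarrow> (\<forall>p\<in>Dsh m. pair m w p = 0)"
proof
  assume ann: "\<forall>p\<in>Dsh m. pair m w p = 0"
  have "part (\<lambda>n. sum_list n = k) w \<in> W_R" for k
  proof (rule ccontr)
    assume "part (\<lambda>n. sum_list n = k) w \<notin> W_R"
    note not_in = this[unfolded W_R_eq_span]
    have "part (\<lambda>n. sum_list n = k) w \<in> W_depth_wt m k"
      using w by (auto simp: W_depth_wt_def W_depth_def W_def in_keys_iff lookup_part split: if_splits)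
    then obtain p where p: "p \<in> Dsh m" "p \<in> polys_wt m k"
        "pair m (part (\<lambda>n. sum_list n = k) w) p \<noteq> 0"
      by (rule Dsh_separates[OF _ not_in Un_upper1])
    then show False using ann pair_part_symb[OF w p(2)] by simp
  qed
  then have "(\<Sum>k\<in>sum_list ` Poly_Mapping.keys w. part (\<lambda>n. sum_list n = k) w) \<in> W_R"
    by (intro pm.subspace_sum[OF pm_subspace_W_R])
  then show "w \<in> W_R" by (subst (asm) sum_parts) auto
qed (use pair_eq_0_on_W_R[OF m] in blast)

lemma W_R_subset_W: "W_R \<subseteq> (W :: 'k::field symb set)"
  unfolding W_R_eq_span
proof (rule pm.span_minimal[OF _ pm_subspace_W])
  have "(star_rel p q a :: 'k symb) \<in> W" "(sh_rel p q a :: 'k symb) \<in> W" if "1 \<le> p" "1 \<le> q" for p q a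
    using star_rel_in_W[OF that, of a] sh_rel_in_W[OF that, of a] W_depth_wt_subset W_depth_subset_W by blast+
  moreover have "symb [2 * n] \<in> (W :: 'k symb set)" if "1 \<le> n" for n
    using that by (auto simp: W_def symb_def indices_def)
  ultimately show "star_coeffs \<union> sh_coeffs \<union> {symb [2 * n] |n. 1 \<le> n} \<subseteq> (W :: 'k symb set)"
    unfolding star_rel_eq sh_rel_eq by blast
qed

text \<open>A vector outside W_R would pair nontrivially with an element of Dsh_m of odd degree k -
  m, and such elements vanish.\<close>

lemma W_depth_wt_subset_W_R:
  assumes m: "2 \<le> m" and k: "odd (k + m)"
  shows "W_depth_wt m k \<subseteq> (W_R :: 'k::field_char_0 symb set)"
proof
  fix w :: "'k symb" assume w: "w \<in> W_depth_wt m k"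
  show "w \<in> W_R"
  proof (rule ccontr)
    assume "w \<notin> W_R"
    note not_in = this[unfolded W_R_eq_span]
    obtain p where "p \<in> Dsh m" "p \<in> polys_wt m k" "pair m w p \<noteq> 0"
      by (rule Dsh_separates[OF w not_in Un_upper1])
    moreover from this have "p = 0" by (intro Dsh_eq_0_if_odd[OF m _ _ k])
    ultimately show False by simp
  qed
qed

lemma W_depth_wt_1:
  assumes "w \<in> W_depth_wt 1 k"
  shows "w = pscale (Poly_Mapping.lookup w [k]) (symb [k])"
proof -
  have "n = [k]" if "n \<in> Poly_Mapping.keys w" for n
  proof -
    have "length n = 1" "sum_list n = k" using assms that by (auto simp: W_depth_wt_def W_depth_def)
    then show ?thesis by (auto simp: length_Suc_conv)
  qed
  then have "Poly_Mapping.keys w \<subseteq> {[k]}" by blast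
  then show ?thesis using poly_mapping_sum_singles[of "{[k]}" w] by (simp add: symb_def)
qed

text \<open>Only products of degree \<open>mdeg a\<close> contribute at a, and negating all
  differences multiplies these by (-1)^(mdeg a).\<close>

lemma colon_series_uminus:
  fixes ts :: "'k::field mpol list"
  assumes ts: "length ts = Suc m" and hom: "\<And>i. i < m \<Longrightarrow> homog 1 (ts ! i - ts ! m)"
  shows "colon_series (map uminus ts) a = pscale ((- 1) ^ mdeg a) (colon_series ts a)"
proof -
  define P where "P n = (\<Prod>i<m. (ts ! i - ts ! m) ^ (n ! i - 1))" for n
  have neg: "(\<Prod>i<m. (map uminus ts ! i - map uminus ts ! m) ^ (n ! i - 1))
      = pscale ((- 1) ^ (\<Sum>i<m. n ! i - 1)) (P n)" for n
  proof -
    have "(\<Prod>i<m. (map uminus ts ! i - map uminus ts ! m) ^ (n ! i - 1))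
        = (\<Prod>i<m. (- (ts ! i - ts ! m)) ^ (n ! i - 1))"
      using ts by (intro prod.cong) auto
    also have "\<dots> = (- 1) ^ (\<Sum>i<m. n ! i - 1) * P n"
      unfolding P_def power_minus[of "ts ! _ - _"] prod.distrib power_sum ..
    also have "\<dots> = pscale ((- 1) ^ (\<Sum>i<m. n ! i - 1)) (P n)"
      by (cases "even (\<Sum>i<m. n ! i - 1)") simp_all
    finally show ?thesis .
  qed
  have "(\<Sum>i<m. n ! i - 1) = mdeg a" if "Poly_Mapping.lookup (P n) a \<noteq> 0" for n
    using that homog_prod_power[of "{..<m}" "\<lambda>i. ts ! i - ts ! m" "\<lambda>i. n ! i - 1"] hom
    unfolding P_def[symmetric] by (auto simp: homog_def in_keys_iff)
  then have c: "Poly_Mapping.lookup (pscale ((- 1) ^ (\<Sum>i<m. n ! i - 1)) (P n)) a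
      = (- 1) ^ mdeg a * Poly_Mapping.lookup (P n) a" for n
    by (cases "Poly_Mapping.lookup (P n) a = 0") (simp_all add: lookup_pscale)
  have len: "length (map uminus ts) - 1 = m" "length ts - 1 = m" using ts by simp_all
  show ?thesis
    unfolding colon_series_def Let_def len neg c P_def[symmetric]
    by (simp add: pm.scale_sum_right)
qed

text \<open>By homogeneity a distribution relation is 0 in even degree and twice a coefficient of
  the series in odd degree. In odd degree the sum of weight and depth is odd too: for m \<ge> 2
  \<open>W_depth_wt_subset_W_R\<close> applies, and in depth 1 the coefficient is a multiple of some
  I(2n).\<close>

lemma D_relations_eq: "D_relations = (W_R :: 'k::field_char_0 symb set)"
proof
  have hom: "homog 1 ((map X [1..<m + 2] ! i - map X [1..<m + 2] ! m) :: 'k mpol)" if "i < m" for i m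
    using that by (simp del: One_nat_def) (intro homog_diff homog_X)
  have len: "length (map X [1..<m + 2]) = Suc m" for m by simp
  have dist: "colon_series (map X [1..<m + 2]) a - colon_series (map (\<lambda>i. - X i) [1..<m + 2]) a
      = (if even (mdeg a) then 0 else pscale 2 (colon_series (map X [1..<m + 2]) a :: 'k symb))" for m a
  proof -
    have two: "pscale 2 w = w + w" for w :: "'k symb"
      by (rule poly_mapping_eqI) (simp add: lookup_pscale lookup_add)
    have "map uminus (map X [1..<m + 2]) = map (\<lambda>i. - X i :: 'k mpol) [1..<m + 2]" by simp
    from colon_series_uminus[OF len hom, where a = a and m = m, unfolded this] show ?thesis
      by (simp only: two) (simp del: One_nat_def)
  qed
  show "D_relations \<subseteq> (W_R :: 'k symb set)"
    unfolding D_relations_def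
  proof (rule pm.span_minimal[OF _ pm_subspace_W_R])
    have "colon_series (map X [1..<m + 2]) a \<in> (W_R :: 'k symb set)" if m: "1 \<le> m" and a: "odd (mdeg a)" for m a
    proof -
      have wt: "(colon_series (map X [1..<m + 2]) a :: 'k symb) \<in> W_depth_wt m (mdeg a + m)"
        by (rule colon_series_in_W[OF len hom m])
      show ?thesis
      proof (cases "m = 1")
        case True
        obtain n where n: "mdeg a + 1 = 2 * n" using a by (metis odd_even_add odd_one evenE)
        then have "1 \<le> n" by simp
        then have "symb [mdeg a + 1] \<in> (W_R :: 'k symb set)"
          unfolding W_R_eq_span n by (intro pm.span_base) blast
        then show ?thesis
          using W_depth_wt_1[of _ "mdeg a + 1"] wt True pm.subspace_scale[OF pm_subspace_W_R] by metis
      next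
        case False
        then show ?thesis using W_depth_wt_subset_W_R[of m "mdeg a + m"] m a wt by auto
      qed
    qed
    then have "distribution_coeffs \<subseteq> (W_R :: 'k symb set)"
      unfolding distribution_coeffs_def dist
      by (auto intro: pm.subspace_scale[OF pm_subspace_W_R] pm.subspace_0[OF pm_subspace_W_R])
    moreover have "star_coeffs \<union> sh_coeffs \<subseteq> (W_R :: 'k symb set)"
      unfolding W_R_eq_span by (rule order_trans[OF _ pm.span_superset]) blast
    ultimately show "star_coeffs \<union> sh_coeffs \<union> distribution_coeffs \<subseteq> (W_R :: 'k symb set)" by blast
  qed
  have "symb [2 * n] \<in> (D_relations :: 'k symb set)" if n: "1 \<le> n" for n
  proof -
    \<comment> \<open>The degree belonging to I(2n) in depth 1. A coefficient of the series in this
      degree is a multiple of I(2n); any a at which (t_1 - t_2)^d has a nonzero coefficient makes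
      the multiple nonzero, and the factor is divided out along with the 2.\<close>
    define d where "d = 2 * n - 1"
    let ?P = "(X 1 - X 2) ^ d :: 'k mpol"
    \<comment> \<open>Setting t_2 to 0 shows that the power of the difference is not 0.\<close>
    have "poly_subst (\<lambda>i. if i = 1 then X 1 else 0) ?P = (X 1 ^ d :: 'k mpol)"
      by (simp add: poly_subst_power poly_subst_diff)
    also have "\<dots> \<noteq> 0" by (simp add: X_power) (metis lookup_single_eq lookup_zero one_neq_zero)
    finally have "?P \<noteq> 0" by (metis poly_subst_0)
    then obtain a where a: "Poly_Mapping.lookup ?P a \<noteq> 0" by (metis lookup_zero poly_mapping_eqI)
    have "homog d ?P" using n by (intro homog_power homog_diff homog_X)
    then have deg: "mdeg a = d" using a by (simp add: homog_def in_keys_iff)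
    let ?ts = "map X [1..<1 + 2] :: 'k mpol list"
    let ?w = "colon_series ?ts a :: 'k symb"
    have d: "d + 1 = 2 * n" using n by (simp add: d_def)
    have "?w \<in> W_depth_wt 1 (mdeg a + 1)" by (rule colon_series_in_W[OF len hom]) auto
    then obtain c where w: "?w = pscale c (symb [2 * n])"
      using W_depth_wt_1[of ?w "2 * n"] deg d by metis
    have sub: "pm.subspace (D_relations :: 'k symb set)"
      unfolding D_relations_def by (rule pm.subspace_span)
    have "odd (mdeg a)" using deg n by (simp add: d_def)
    then have "pscale 2 ?w = colon_series (map X [1..<1 + 2]) a - colon_series (map (\<lambda>i. - X i) [1..<1 + 2]) a"
      unfolding dist by simp
    then have "pscale 2 ?w \<in> distribution_coeffs"
      unfolding distribution_coeffs_def by blast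
    then have "pscale 2 ?w \<in> D_relations"
      unfolding D_relations_def by (intro pm.span_base) blast
    from pm.subspace_scale[OF sub this, of "1 / 2"] have wD: "?w \<in> D_relations" by simp
    have "pair 1 ?w (X 1 ^ d) = Poly_Mapping.lookup (poly_subst (\<lambda>j. ?ts ! (1 - j) - ?ts ! 1) (X 1 ^ d)) a"
      by (rule pair_colon_series[OF len hom]) (auto simp: polys_def X_power)
    also have "\<dots> = Poly_Mapping.lookup ?P a" by (simp add: poly_subst_power numeral_2_eq_2)
    finally have "?w \<noteq> 0" using a by auto
    then have "c \<noteq> 0" using w by auto
    then have "pscale (1 / c) ?w = symb [2 * n]" unfolding w by simp
    then show ?thesis using pm.subspace_scale[OF sub wD] by metis
  qed
  then show "W_R \<subseteq> (D_relations :: 'k symb set)"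
    unfolding W_R_eq_span D_relations_def
    by (intro pm.span_minimal pm.subspace_span) (auto intro: pm.span_base)
qed

section \<open>Quotients and induced maps\<close>

definition graded_onto ::
    "('i, 'k, 'v) graded_space \<Rightarrow> ('i, 'k, 'w) graded_space \<Rightarrow> ('v \<Rightarrow> 'w) \<Rightarrow> bool" where
  "graded_onto V V' f \<longleftrightarrow>
     f ` gcarrier V = gcarrier V' \<and>
     (\<forall>u \<in> gcarrier V. \<forall>v \<in> gcarrier V. f (gadd V u v) = gadd V' (f u) (f v)) \<and>
     (\<forall>c. \<forall>v \<in> gcarrier V. f (gscale V c v) = gscale V' c (f v)) \<and>
     (\<forall>i. f ` component V i = component V' i)"

text \<open>A linear subspace of the carrier; the word graded refers to the record type of
  V.\<close>

definition graded_subspace :: "('i, 'k, 'v) graded_space \<Rightarrow> 'v::ab_group_add set \<Rightarrow> bool" where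
  "graded_subspace V U \<longleftrightarrow> U \<subseteq> gcarrier V \<and> 0 \<in> U \<and>
     (\<forall>u \<in> U. \<forall>v \<in> U. u + v \<in> U) \<and> (\<forall>c. \<forall>u \<in> U. gscale V c u \<in> U)"

text \<open>The record carries no laws. These are the ones that cosets require, with the addition of
  the type as the operation; the law for -1 makes subspaces closed under negation.\<close>

definition graded_vector_space :: "('i, 'k::field, 'v::ab_group_add) graded_space \<Rightarrow> bool" where
  "graded_vector_space V \<longleftrightarrow> gadd V = (+) \<and> graded_subspace V (gcarrier V) \<and>
     (\<forall>c u v. gscale V c (u + v) = gscale V c u + gscale V c v) \<and>
     (\<forall>u. gscale V (- 1) u = - u) \<and> (\<forall>i. component V i \<subseteq> gcarrier V)"

text \<open>Two surjections from V with the same fibres have targets that correspond bijectively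
  under F; additivity, homogeneity and the components are checked on representatives in V.\<close>

lemma graded_iso_factor:
  assumes V: "graded_vector_space V"
    and \<pi>: "graded_onto V Q \<pi>" and f: "graded_onto V V' f"
    and ker: "\<And>u v. u \<in> gcarrier V \<Longrightarrow> v \<in> gcarrier V \<Longrightarrow> f u = f v \<longleftrightarrow> \<pi> u = \<pi> v"
    and F: "\<And>v. v \<in> gcarrier V \<Longrightarrow> F (\<pi> v) = f v"
  shows "graded_iso Q V' F"
proof -
  have sub: "gadd V u v \<in> gcarrier V" "gscale V c u \<in> gcarrier V"
    if "u \<in> gcarrier V" "v \<in> gcarrier V" for u v c
    using V that by (auto simp: graded_vector_space_def graded_subspace_def)
  have comp: "component V i \<subseteq> gcarrier V" for i
    using V by (auto simp: graded_vector_space_def)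
  have Q: "gcarrier Q = \<pi> ` gcarrier V" and V': "gcarrier V' = f ` gcarrier V"
    using \<pi> f by (simp_all add: graded_onto_def)
  have "inj_on F (gcarrier Q)"
    unfolding Q by (rule inj_onI) (auto simp: F ker)
  moreover have "F ` gcarrier Q = gcarrier V'"
    unfolding Q V' image_image by (rule image_cong) (auto simp: F)
  ultimately have "bij_betw F (gcarrier Q) (gcarrier V')" by (simp add: bij_betw_def)
  moreover have "F (gadd Q x y) = gadd V' (F x) (F y)" if xy: "x \<in> gcarrier Q" "y \<in> gcarrier Q" for x y
  proof -
    obtain u v where uv: "u \<in> gcarrier V" "v \<in> gcarrier V" "x = \<pi> u" "y = \<pi> v"
      using xy unfolding Q by blast
    then have "gadd Q x y = \<pi> (gadd V u v)" using \<pi> by (simp add: graded_onto_def)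
    then show ?thesis using uv sub f by (simp add: F graded_onto_def)
  qed
  moreover have "F (gscale Q c x) = gscale V' c (F x)" if x: "x \<in> gcarrier Q" for x c
  proof -
    obtain u where u: "u \<in> gcarrier V" "x = \<pi> u" using x unfolding Q by blast
    then have "gscale Q c x = \<pi> (gscale V c u)" using \<pi> by (simp add: graded_onto_def)
    then show ?thesis using u sub f by (simp add: F graded_onto_def)
  qed
  moreover have "F ` component Q i = component V' i" for i
  proof -
    have "F ` component Q i = F ` \<pi> ` component V i" using \<pi> by (simp add: graded_onto_def)
    also have "\<dots> = f ` component V i"
      unfolding image_image by (intro image_cong refl F) (use comp in blast)
    finally show ?thesis using f by (simp add: graded_onto_def)
  qed
  ultimately show ?thesis by (simp add: graded_iso_def)
qed

lemma graded_onto_comp: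
  assumes "graded_vector_space V" "graded_onto V V' f" "graded_onto V' V'' g"
  shows "graded_onto V V'' (\<lambda>v. g (f v))"
proof -
  have V': "f v \<in> gcarrier V'" if "v \<in> gcarrier V" for v
    using assms(2) that by (auto simp: graded_onto_def)
  have "(\<lambda>v. g (f v)) ` A = g ` f ` A" for A by (simp add: image_image)
  then show ?thesis using assms by (simp add: graded_onto_def V')
qed

context
  fixes V :: "('i, 'k::field, 'v::ab_group_add) graded_space" and U :: "'v set"
  assumes V: "graded_vector_space V" and U: "graded_subspace V U"
begin

lemma minus_mem: "u \<in> U \<Longrightarrow> - u \<in> U"
  using V U unfolding graded_vector_space_def graded_subspace_def by metis

lemma coset_eq: "coset V U v = (+) v ` U"
  using V by (simp add: coset_def graded_vector_space_def)

lemma mem_coset_iff: "w \<in> coset V U v \<longleftrightarrow> w - v \<in> U"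
  unfolding coset_eq by (auto intro: image_eqI[of _ _ "w - v"])

lemma coset_eq_iff: "coset V U u = coset V U v \<longleftrightarrow> u - v \<in> U"
proof
  assume "coset V U u = coset V U v"
  moreover have "u \<in> coset V U u" using U by (simp add: mem_coset_iff graded_subspace_def)
  ultimately show "u - v \<in> U" by (simp add: mem_coset_iff)
next
  assume uv: "u - v \<in> U"
  have "w - u \<in> U \<longleftrightarrow> w - v \<in> U" for w
  proof
    assume "w - u \<in> U"
    then have "(w - u) + (u - v) \<in> U" using uv U unfolding graded_subspace_def by blast
    then show "w - v \<in> U" by simp
  next
    assume "w - v \<in> U"
    then have "(w - v) + - (u - v) \<in> U" using minus_mem[OF uv] U unfolding graded_subspace_def by blast
    then show "w - u \<in> U" by simp
  qed
  then show "coset V U u = coset V U v" by (auto simp: mem_coset_iff)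
qed

text \<open>The union in \<open>quotient_space\<close> runs over a nonempty family of equal cosets,
  since the sum does not depend on the representatives.\<close>

lemma gadd_coset: "gadd (quotient_space V U) (coset V U u) (coset V U v) = coset V U (u + v)"
proof -
  have "coset V U (gadd V a b) = coset V U (u + v)" if "a \<in> coset V U u" "b \<in> coset V U v" for a b
  proof -
    have "(a - u) + (b - v) \<in> U" using that U unfolding mem_coset_iff graded_subspace_def by blast
    then show ?thesis
      using V by (simp add: coset_eq_iff graded_vector_space_def algebra_simps)
  qed
  then have "gadd (quotient_space V U) (coset V U u) (coset V U v)
      = (\<Union>a\<in>coset V U u. \<Union>b\<in>coset V U v. coset V U (u + v))"
    unfolding quotient_space_def by simp
  moreover have "u \<in> coset V U u" "v \<in> coset V U v"
    using U by (simp_all add: mem_coset_iff graded_subspace_def)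
  ultimately show ?thesis by auto
qed

lemma gscale_coset: "gscale (quotient_space V U) c (coset V U v) = coset V U (gscale V c v)"
proof -
  have "coset V U (gscale V c a) = coset V U (gscale V c v)" if "a \<in> coset V U v" for a
  proof -
    have "gscale V c (a - v) \<in> U" using that U unfolding mem_coset_iff graded_subspace_def by blast
    moreover have "gscale V c a = gscale V c (a - v) + gscale V c v"
      using V unfolding graded_vector_space_def by (metis diff_add_cancel)
    ultimately show ?thesis by (simp add: coset_eq_iff)
  qed
  then have "gscale (quotient_space V U) c (coset V U v) = (\<Union>a\<in>coset V U v. coset V U (gscale V c v))"
    unfolding quotient_space_def by simp
  moreover have "v \<in> coset V U v" using U by (simp add: mem_coset_iff graded_subspace_def)
  ultimately show ?thesis by auto
qed

lemma graded_onto_coset: "graded_onto V (quotient_space V U) (coset V U)"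
  using V by (auto simp: graded_onto_def gadd_coset gscale_coset graded_vector_space_def)
    (auto simp: quotient_space_def)

lemma induced_coset:
  assumes "\<And>w. w - v \<in> U \<Longrightarrow> f w = f v"
  shows "induced f (coset V U v) = f v"
proof -
  have "f w = f v" if "w \<in> coset V U v" for w
    using assms that unfolding mem_coset_iff .
  moreover have "v \<in> coset V U v" using U by (simp add: mem_coset_iff graded_subspace_def)
  ultimately have "f ` coset V U v = {f v}" by blast
  then show ?thesis by (simp add: induced_def)
qed

end

section \<open>The concrete graded spaces\<close>

lemma pm_graded_vector_space:
  assumes "gadd V = (+)" "gscale V = pscale" "pm.subspace (gcarrier V)" "\<And>i. component V i \<subseteq> gcarrier V"
  shows "graded_vector_space (V :: ('i, 'k::field, 'a \<Rightarrow>\<^sub>0 'k) graded_space)"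
  using assms
  by (auto simp: graded_vector_space_def graded_subspace_def pm.scale_right_distrib
      pm.subspace_0 pm.subspace_add pm.subspace_scale)

lemma pm_graded_subspace:
  assumes "gscale V = pscale" "pm.subspace U" "U \<subseteq> gcarrier V"
  shows "graded_subspace (V :: ('i, 'k::field, 'a \<Rightarrow>\<^sub>0 'k) graded_space) U"
  using assms by (auto simp: graded_subspace_def pm.subspace_0 pm.subspace_add pm.subspace_scale)

lemma graded_vector_space_W_space: "graded_vector_space W_space"
  by (rule pm_graded_vector_space)
    (auto simp: W_space_def pm_subspace_W W_depth_wt_def W_depth_def)

lemma graded_vector_space_W_depth_space: "graded_vector_space (W_depth_space m)"
  by (rule pm_graded_vector_space)
    (auto simp: W_depth_space_def pm_subspace_W_depth W_depth_wt_def)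

lemma graded_subspace_W_R_depth: "graded_subspace (W_depth_space m) (W_R_depth m)"
  by (rule pm_graded_subspace)
    (auto simp: W_depth_space_def W_R_depth_def intro!: pm.subspace_inter pm_subspace_W_R pm_subspace_W_depth)

lemma graded_subspace_W_R: "graded_subspace W_space W_R"
  by (rule pm_graded_subspace)
    (use W_R_subset_W in \<open>auto simp: W_space_def pm_subspace_W_R\<close>)

lemma gadd_graded_dual: "gadd (graded_dual V) = (+)"
  and gscale_graded_dual: "gscale (graded_dual V) c \<phi> = (\<lambda>v. c * \<phi> v)"
  by (simp_all add: graded_dual_def Let_def plus_fun_def fun_eq_iff)

lemma mem_graded_dual_iff:
  "\<phi> \<in> gcarrier (graded_dual V) \<longleftrightarrow> (\<forall>v. v \<notin> gcarrier V \<longrightarrow> \<phi> v = 0) \<and>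
    (\<forall>u \<in> gcarrier V. \<forall>v \<in> gcarrier V. \<phi> (gadd V u v) = \<phi> u + \<phi> v) \<and>
    (\<forall>c. \<forall>v \<in> gcarrier V. \<phi> (gscale V c v) = c * \<phi> v) \<and>
    finite {i. \<exists>v \<in> component V i. \<phi> v \<noteq> 0}"
  by (simp add: graded_dual_def Let_def)

lemma component_graded_dual:
  "component (graded_dual V) i =
    {\<phi> \<in> gcarrier (graded_dual V). \<forall>j. j \<noteq> i \<longrightarrow> (\<forall>v \<in> component V j. \<phi> v = 0)}"
  by (simp add: graded_dual_def Let_def)

lemma graded_vector_space_graded_dual: "graded_vector_space (graded_dual V)"
proof -
  have add: "\<phi> + \<psi> \<in> gcarrier (graded_dual V)"
    if "\<phi> \<in> gcarrier (graded_dual V)" "\<psi> \<in> gcarrier (graded_dual V)" for \<phi> \<psi>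
  proof -
    have "finite ({i. \<exists>v \<in> component V i. \<phi> v \<noteq> 0} \<union> {i. \<exists>v \<in> component V i. \<psi> v \<noteq> 0})"
      using that by (simp add: mem_graded_dual_iff)
    then have "finite {i. \<exists>v \<in> component V i. (\<phi> + \<psi>) v \<noteq> 0}"
      by (rule rev_finite_subset) auto
    then show ?thesis using that by (simp add: mem_graded_dual_iff distrib_left)
  qed
  have scale: "(\<lambda>v. c * \<phi> v) \<in> gcarrier (graded_dual V)"
    if "\<phi> \<in> gcarrier (graded_dual V)" for \<phi> c
  proof -
    have "finite {i. \<exists>v \<in> component V i. c * \<phi> v \<noteq> 0}"
      by (rule rev_finite_subset[of "{i. \<exists>v \<in> component V i. \<phi> v \<noteq> 0}"])
        (use that in \<open>auto simp: mem_graded_dual_iff\<close>)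
    then show ?thesis using that by (simp add: mem_graded_dual_iff distrib_left mult.left_commute)
  qed
  have zero: "0 \<in> gcarrier (graded_dual V)" by (simp add: mem_graded_dual_iff)
  show ?thesis
    unfolding graded_vector_space_def graded_subspace_def gadd_graded_dual gscale_graded_dual
    by (intro conjI allI ballI subset_refl zero add scale)
      (auto simp: component_graded_dual fun_eq_iff distrib_left)
qed

section \<open>The dual of the polynomial ring\<close>

lemma single_expo_in: "n \<in> indices m \<Longrightarrow> Poly_Mapping.single (expo n) 1 \<in> polys_wt m (sum_list n)"
  using keys_expo[of n] mdeg_expo[of n m] by (auto simp: polys_wt_def polys_def indices_def)

lemma prod_X_expo:
  assumes "length n = m"
  shows "(\<Prod>i = 1..m. X i ^ (n ! (m - i) - 1)) = (Poly_Mapping.single (expo n) 1 :: 'k::field mpol)"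
  using assms by (simp add: prod_X_power expo_def)

context
  fixes m :: nat and \<phi> :: "'k::field mpol \<Rightarrow> 'k"
  assumes \<phi>: "\<phi> \<in> gcarrier (graded_dual (poly_space m))"
begin

lemma form_add: "p \<in> polys m \<Longrightarrow> q \<in> polys m \<Longrightarrow> \<phi> (p + q) = \<phi> p + \<phi> q"
  and form_pscale: "p \<in> polys m \<Longrightarrow> \<phi> (pscale c p) = c * \<phi> p"
  and form_finite: "finite {k. \<exists>p \<in> polys_wt m k. \<phi> p \<noteq> 0}"
  using \<phi> by (auto simp: mem_graded_dual_iff poly_space_def)

lemma form_0: "\<phi> 0 = 0"
  using form_pscale[OF pm.subspace_0[OF pm_subspace_polys], of 0] by simp

text \<open>A form in the graded dual is nonzero in finitely many weights only, and each weight has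
  finitely many symbols of depth m. Hence the sum in \<open>h_map\<close> is a genuine one, not 0 by
  convention.\<close>

lemma finite_form_support: "finite {n \<in> indices m. \<phi> (Poly_Mapping.single (expo n) 1) \<noteq> 0}"
proof (rule finite_subset)
  show "{n \<in> indices m. \<phi> (Poly_Mapping.single (expo n) 1) \<noteq> 0}
      \<subseteq> (\<Union>k\<in>{k. \<exists>p \<in> polys_wt m k. \<phi> p \<noteq> 0}. {n \<in> indices m. sum_list n = k})"
    using single_expo_in[of _ m] by blast
qed (simp add: form_finite finite_indices_wt)

lemma lookup_h_map:
  "Poly_Mapping.lookup (h_map m \<phi>) n
    = (if n \<in> indices m then \<phi> (Poly_Mapping.single (expo n) 1) else 0)"
proof -
  have c: "\<phi> (\<Prod>i = 1..m. X i ^ (n ! (m - i) - 1)) = \<phi> (Poly_Mapping.single (expo n) 1)"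
    if "n \<in> indices m" for n
  proof -
    have "length n = m" using that by (simp add: indices_def)
    then show ?thesis by (simp only: prod_X_expo)
  qed
  let ?N = "{n \<in> indices m. \<phi> (Poly_Mapping.single (expo n) 1) \<noteq> 0}"
  have "h_map m \<phi> = (\<Sum>n\<in>?N. pscale (\<phi> (Poly_Mapping.single (expo n) 1)) (symb n))"
    unfolding h_map_def Let_def by (rule sum.cong) (auto simp only: c mem_Collect_eq)
  then have "Poly_Mapping.lookup (h_map m \<phi>) n
      = (\<Sum>n'\<in>?N. if n' = n then \<phi> (Poly_Mapping.single (expo n') 1) else 0)"
    by (simp add: lookup_sum lookup_pscale symb_def lookup_single when_def if_distrib cong: if_cong)
  then show ?thesis by (auto simp: sum.delta[OF finite_form_support])
qed

lemma h_map_in_W_depth: "1 \<le> m \<Longrightarrow> h_map m \<phi> \<in> W_depth m"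
  by (auto simp: W_depth_def W_def in_keys_iff lookup_h_map indices_def split: if_splits)

lemma pair_h_map:
  assumes m: "1 \<le> m" and p: "p \<in> polys m"
  shows "pair m (h_map m \<phi>) p = \<phi> p"
proof -
  have single: "pair m (h_map m \<phi>) (Poly_Mapping.single a 1) = \<phi> (Poly_Mapping.single a 1)"
    if "Poly_Mapping.keys a \<subseteq> {1..m}" for a
  proof -
    obtain n where n: "n \<in> indices m" "expo n = a" using expo_surj \<open>Poly_Mapping.keys a \<subseteq> {1..m}\<close> by metis
    have "pair m (h_map m \<phi>) (Poly_Mapping.single a 1)
        = (\<Sum>n'\<in>Poly_Mapping.keys (h_map m \<phi>). if n' = n then Poly_Mapping.lookup (h_map m \<phi>) n' else 0)"
      unfolding pair_def n(2)[symmetric]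
      by (rule sum.cong) (auto simp: lookup_single when_def n(1) inj_on_eq_iff[OF inj_on_expo n(1)] lookup_h_map)
    also have "\<dots> = \<phi> (Poly_Mapping.single a 1)"
      using n by (simp add: lookup_h_map in_keys_iff)
    finally show ?thesis .
  qed
  \<comment> \<open>Membership in \<open>polys m\<close> is carried through the induction because
    \<phi> is additive only there.\<close>
  have "(\<Sum>a\<in>A. pscale (f a) (Poly_Mapping.single a 1)) \<in> polys m \<and>
      pair m (h_map m \<phi>) (\<Sum>a\<in>A. pscale (f a) (Poly_Mapping.single a 1))
        = \<phi> (\<Sum>a\<in>A. pscale (f a) (Poly_Mapping.single a 1))"
    if "finite A" "\<And>a. a \<in> A \<Longrightarrow> Poly_Mapping.keys a \<subseteq> {1..m}" for A f
    using that
  proof (induction A rule: finite_induct)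
    case empty
    then show ?case by (simp add: form_0 pm.subspace_0[OF pm_subspace_polys])
  next
    case (insert a A)
    have a: "(Poly_Mapping.single a 1 :: 'k mpol) \<in> polys m"
      using insert.prems by (simp add: polys_def)
    show ?case
      using insert.IH insert.prems insert.hyps
      by (simp add: pair_add_right pair_pscale_right form_add form_pscale a single
          pm.subspace_add[OF pm_subspace_polys] pm.subspace_scale[OF pm_subspace_polys])
  qed
  from this[of "Poly_Mapping.keys p" "Poly_Mapping.lookup p"] p show ?thesis
    by (simp add: poly_mapping_sum_singles polys_def)
qed

end

text \<open>The inverse of \<open>h_map\<close>. The value 0 outside \<open>polys m\<close> is the
  convention of \<open>graded_dual\<close>.\<close>

definition form_of :: "nat \<Rightarrow> 'k::field symb \<Rightarrow> 'k mpol \<Rightarrow> 'k" where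
  "form_of m w p = (if p \<in> polys m then pair m w p else 0)"

lemma pair_eq_0_of_wt:
  assumes "w \<in> W_depth m" "p \<in> polys_wt m k" "\<And>n. n \<in> Poly_Mapping.keys w \<Longrightarrow> sum_list n \<noteq> k"
  shows "pair m w p = 0"
proof -
  have "part (\<lambda>n. sum_list n = k) w = 0"
    using assms(3) by (intro poly_mapping_eqI) (auto simp: lookup_part in_keys_iff)
  then show ?thesis using pair_part_symb[OF assms(1,2)] by simp
qed

lemma form_of_in_dual:
  assumes w: "w \<in> W_depth m"
  shows "form_of m w \<in> gcarrier (graded_dual (poly_space m))"
proof -
  have "finite {k. \<exists>p\<in>polys_wt m k. form_of m w p \<noteq> 0}"
  proof (rule finite_subset)
    show "{k. \<exists>p\<in>polys_wt m k. form_of m w p \<noteq> 0} \<subseteq> sum_list ` Poly_Mapping.keys w"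
    proof
      fix k assume "k \<in> {k. \<exists>p\<in>polys_wt m k. form_of m w p \<noteq> 0}"
      then obtain p where "p \<in> polys_wt m k" "pair m w p \<noteq> 0"
        by (auto simp: form_of_def split: if_splits)
      then show "k \<in> sum_list ` Poly_Mapping.keys w" using pair_eq_0_of_wt[OF w] by blast
    qed
  qed simp
  then show ?thesis
    by (simp add: mem_graded_dual_iff poly_space_def form_of_def pair_add_right pair_pscale_right
        pm.subspace_add[OF pm_subspace_polys] pm.subspace_scale[OF pm_subspace_polys])
qed

lemma h_map_form_of:
  assumes w: "w \<in> W_depth m"
  shows "h_map m (form_of m w) = w"
proof (rule poly_mapping_eqI)
  fix n
  have "pair m w (Poly_Mapping.single (expo n) 1) = Poly_Mapping.lookup w n" if n: "n \<in> indices m"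
  proof -
    have "pair m w (Poly_Mapping.single (expo n) 1)
        = (\<Sum>n'\<in>Poly_Mapping.keys w. if n' = n then Poly_Mapping.lookup w n' else 0)"
      unfolding pair_conv_keys[OF w]
      by (rule sum.cong) (auto simp: lookup_single when_def inj_on_eq_iff[OF inj_on_expo n] keys_W_depth[OF w])
    then show ?thesis by (simp add: in_keys_iff)
  qed
  moreover have "Poly_Mapping.lookup w n = 0" if "n \<notin> indices m"
    using keys_W_depth[OF w, of n] that by (auto simp: in_keys_iff)
  moreover have "(Poly_Mapping.single (expo n) 1 :: 'a mpol) \<in> polys m" if "n \<in> indices m"
    using single_expo_in[OF that] by (auto simp: polys_wt_def)
  ultimately show "Poly_Mapping.lookup (h_map m (form_of m w)) n = Poly_Mapping.lookup w n"
    by (simp add: lookup_h_map[OF form_of_in_dual[OF w]] form_of_def)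
qed

lemma graded_onto_h_map:
  assumes m: "1 \<le> m"
  shows "graded_onto (graded_dual (poly_space m)) (W_depth_space m :: (nat, 'k::field, 'k symb) graded_space) (h_map m)"
proof -
  let ?V = "graded_dual (poly_space m :: (nat, 'k, 'k mpol) graded_space)"
  note V = graded_vector_space_graded_dual[of "poly_space m :: (nat, 'k, 'k mpol) graded_space"]
  have closed: "\<phi> + \<psi> \<in> gcarrier ?V" "(\<lambda>v. c * \<phi> v) \<in> gcarrier ?V"
    if "\<phi> \<in> gcarrier ?V" "\<psi> \<in> gcarrier ?V" for \<phi> \<psi> c
    using V that unfolding graded_vector_space_def graded_subspace_def gscale_graded_dual by blast+
  have "h_map m ` gcarrier ?V = W_depth m"
  proof
    show "W_depth m \<subseteq> h_map m ` gcarrier ?V"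
    proof
      fix w :: "'k symb" assume w: "w \<in> W_depth m"
      then show "w \<in> h_map m ` gcarrier ?V"
        by (intro image_eqI[of _ _ "form_of m w"]) (simp_all add: h_map_form_of form_of_in_dual)
    qed
  qed (use h_map_in_W_depth m in blast)
  moreover have "h_map m ` component ?V k = W_depth_wt m k" for k
  proof
    show "h_map m ` component ?V k \<subseteq> W_depth_wt m k"
    proof
      fix w assume "w \<in> h_map m ` component ?V k"
      then obtain \<phi> where \<phi>: "\<phi> \<in> gcarrier ?V" "w = h_map m \<phi>"
        and 0: "\<And>j p. j \<noteq> k \<Longrightarrow> p \<in> polys_wt m j \<Longrightarrow> \<phi> p = 0"
        by (auto simp: component_graded_dual poly_space_def)
      have "sum_list n = k" if "n \<in> Poly_Mapping.keys w" for n
        using that 0 single_expo_in[of n m]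
        by (auto simp: in_keys_iff \<phi>(2) lookup_h_map[OF \<phi>(1)] split: if_splits)
      then show "w \<in> W_depth_wt m k"
        using h_map_in_W_depth[OF \<phi>(1) m] by (simp add: W_depth_wt_def \<phi>(2))
    qed
    show "W_depth_wt m k \<subseteq> h_map m ` component ?V k"
    proof
      fix w :: "'k symb" assume w: "w \<in> W_depth_wt m k"
      then have w': "w \<in> W_depth m" using W_depth_wt_subset by blast
      have "form_of m w p = 0" if "j \<noteq> k" "p \<in> polys_wt m j" for j p
        using that w pair_eq_0_of_wt[OF w' that(2)] by (auto simp: form_of_def W_depth_wt_def)
      then have "form_of m w \<in> component ?V k"
        using form_of_in_dual[OF w'] by (simp add: component_graded_dual poly_space_def)
      then show "w \<in> h_map m ` component ?V k" using h_map_form_of[OF w'] by force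
    qed
  qed
  moreover have "h_map m (\<phi> + \<psi>) = h_map m \<phi> + h_map m \<psi>" if "\<phi> \<in> gcarrier ?V" "\<psi> \<in> gcarrier ?V" for \<phi> \<psi>
    using that closed(1)[OF that] by (intro poly_mapping_eqI) (simp add: lookup_h_map lookup_add)
  moreover have "h_map m (\<lambda>v. c * \<phi> v) = pscale c (h_map m \<phi>)" if "\<phi> \<in> gcarrier ?V" for c \<phi>
    using that closed(2)[OF that that] by (intro poly_mapping_eqI) (simp add: lookup_h_map lookup_pscale)
  ultimately show ?thesis
    by (simp add: graded_onto_def W_depth_space_def gadd_graded_dual gscale_graded_dual)
qed

text \<open>Surjectivity needs forms to be extended from Dsh_m, but a linear extension may be
  nonzero in infinitely many weights. Composing it with the projections onto the finitely many
  weights where the given form is nonzero repairs this. The values on Dsh_m do not change, since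
  weight components of its elements stay in Dsh_m.\<close>

lemma graded_onto_restrict_form:
  "graded_onto (graded_dual (poly_space m :: (nat, 'k::field, 'k mpol) graded_space))
     (graded_dual (Dsh_space m)) (restrict_form (Dsh m))"
proof -
  let ?V = "graded_dual (poly_space m :: (nat, 'k, 'k mpol) graded_space)"
  let ?D = "graded_dual (Dsh_space m :: (nat, 'k, 'k mpol) graded_space)"
  let ?r = "restrict_form (Dsh m) :: ('k mpol \<Rightarrow> 'k) \<Rightarrow> _"
  note sub = subsetD[OF Dsh_subset_polys]
  have r_in: "?r \<phi> \<in> gcarrier ?D" if \<phi>: "\<phi> \<in> gcarrier ?V" for \<phi>
  proof -
    have "finite {k. \<exists>p\<in>Dsh m \<inter> polys_wt m k. ?r \<phi> p \<noteq> 0}"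
      by (rule finite_subset[OF _ form_finite[OF \<phi>]]) (auto simp: restrict_form_def)
    then show ?thesis
      by (simp add: mem_graded_dual_iff Dsh_space_def restrict_form_def form_add[OF \<phi>] form_pscale[OF \<phi>]
          sub pm.subspace_add[OF pm_subspace_Dsh] pm.subspace_scale[OF pm_subspace_Dsh])
  qed
  have r_comp: "?r \<phi> \<in> component ?D k" if "\<phi> \<in> component ?V k" for \<phi> k
    using that r_in[of \<phi>]
    by (auto simp: component_graded_dual poly_space_def Dsh_space_def restrict_form_def)
  have ext: "\<exists>\<Phi>\<in>gcarrier ?V. ?r \<Phi> = \<phi> \<and> (\<forall>k. \<phi> \<in> component ?D k \<longrightarrow> \<Phi> \<in> component ?V k)"
    if \<phi>: "\<phi> \<in> gcarrier ?D" for \<phi>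
  proof -
    define K where "K = {k. \<exists>p\<in>Dsh m \<inter> polys_wt m k. \<phi> p \<noteq> 0}"
    have \<phi>_D: "finite K" "\<And>p. p \<notin> Dsh m \<Longrightarrow> \<phi> p = 0"
      "\<And>p q. p \<in> Dsh m \<Longrightarrow> q \<in> Dsh m \<Longrightarrow> \<phi> (p + q) = \<phi> p + \<phi> q"
      "\<And>c p. p \<in> Dsh m \<Longrightarrow> \<phi> (pscale c p) = c * \<phi> p"
      using \<phi> by (auto simp: K_def mem_graded_dual_iff Dsh_space_def)
    obtain \<psi> where \<psi>: "Vector_Spaces.linear pscale (*) \<psi>" "\<And>p. p \<in> Dsh m \<Longrightarrow> \<psi> p = \<phi> p"
      using linear_form_extend[OF pm_subspace_Dsh, of m \<phi>] \<phi>_D(3,4) by metis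
    have lin: "\<psi> (u + v) = \<psi> u + \<psi> v" "\<psi> (pscale c v) = c * \<psi> v" for u v c
      using \<psi>(1) by (simp_all add: Vector_Spaces.linear_iff)
    have \<psi>0: "\<psi> 0 = 0" using lin(2)[of 0 0] by simp
    have \<psi>_sum: "\<psi> (sum f A) = (\<Sum>i\<in>A. \<psi> (f i))" for f :: "nat \<Rightarrow> _" and A
      by (induction A rule: infinite_finite_induct) (simp_all add: lin \<psi>0)
    let ?w = "\<lambda>k. part (\<lambda>a. mdeg a + m = k) :: 'k mpol \<Rightarrow> _"
    define \<Phi> where "\<Phi> p = (if p \<in> polys m then \<Sum>k\<in>K. \<psi> (?w k p) else 0)" for p
    have \<Phi>_wt: "\<Phi> p = 0" if "p \<in> polys_wt m j" "j \<notin> K" for p j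
    proof -
      have "?w k p = 0" if "k \<in> K" for k
        using \<open>p \<in> polys_wt m j\<close> \<open>j \<notin> K\<close> that
        by (intro poly_mapping_eqI) (auto simp: lookup_part polys_wt_def in_keys_iff)
      then show ?thesis by (simp add: \<Phi>_def \<psi>0)
    qed
    have "finite {k. \<exists>p\<in>polys_wt m k. \<Phi> p \<noteq> 0}"
      by (rule finite_subset[OF _ \<phi>_D(1)]) (use \<Phi>_wt in blast)
    then have \<Phi>: "\<Phi> \<in> gcarrier ?V"
      by (simp add: mem_graded_dual_iff poly_space_def \<Phi>_def part_add part_pscale lin sum.distrib
          sum_distrib_left pm.subspace_add[OF pm_subspace_polys] pm.subspace_scale[OF pm_subspace_polys])
    have "?r \<Phi> p = \<phi> p" for p
    proof (cases "p \<in> Dsh m")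
      case True
      let ?J = "(\<lambda>a. mdeg a + m) ` Poly_Mapping.keys p"
      have "\<phi> p = \<psi> (\<Sum>j\<in>?J. ?w j p)"
        using \<psi>(2)[OF True] by (subst sum_parts) auto
      also have "\<dots> = (\<Sum>j\<in>?J. \<psi> (?w j p))" by (rule \<psi>_sum)
      also have "\<dots> = (\<Sum>j\<in>K. \<psi> (?w j p))"
      proof (rule sum.mono_neutral_cong)
        fix j assume "j \<in> K - ?J"
        then have "?w j p = 0" by (intro poly_mapping_eqI) (auto simp: lookup_part in_keys_iff)
        then show "\<psi> (?w j p) = 0" by (simp add: \<psi>0)
      next
        fix j assume "j \<in> ?J - K"
        then have "\<phi> (?w j p) = 0" using part_in_Dsh[OF True, of j] by (auto simp: K_def)
        then show "\<psi> (?w j p) = 0" using part_in_Dsh[OF True, of j] \<psi>(2) by auto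
      qed (use \<phi>_D(1) in auto)
      finally show ?thesis using True sub[OF True] by (simp add: restrict_form_def \<Phi>_def)
    qed (simp add: restrict_form_def \<phi>_D(2))
    then have "?r \<Phi> = \<phi>" by (rule ext)
    \<comment> \<open>For a form of pure weight k, K contains at most k, so the extension has pure
      weight too.\<close>
    moreover have "\<Phi> \<in> component ?V k" if "\<phi> \<in> component ?D k" for k
    proof -
      have "K \<subseteq> {k}" using that by (auto simp: K_def component_graded_dual Dsh_space_def)
      then show ?thesis using \<Phi> \<Phi>_wt by (auto simp: component_graded_dual poly_space_def)
    qed
    ultimately show ?thesis using \<Phi> by blast
  qed
  have D_comp: "component ?D k \<subseteq> gcarrier ?D" for k by (auto simp: component_graded_dual)
  have "?r ` gcarrier ?V = gcarrier ?D" using r_in ext by blast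
  moreover have "?r ` component ?V k = component ?D k" for k
  proof
    show "component ?D k \<subseteq> ?r ` component ?V k" using ext D_comp by blast
  qed (use r_comp in blast)
  moreover have "?r (\<phi> + \<psi>) = ?r \<phi> + ?r \<psi>" "?r (\<lambda>v. c * \<phi> v) = (\<lambda>v. c * ?r \<phi> v)" for \<phi> \<psi> c
    by (auto simp: restrict_form_def)
  ultimately show ?thesis by (simp add: graded_onto_def gadd_graded_dual gscale_graded_dual)
qed

section \<open>The isomorphisms\<close>

lemma graded_subspace_Dsh': "graded_subspace (graded_dual (poly_space m)) (Dsh' m)"
  using graded_vector_space_graded_dual[of "poly_space m"]
  unfolding graded_vector_space_def graded_subspace_def gscale_graded_dual Dsh'_def by auto

lemma restrict_form_eq_iff:
  assumes "\<phi> - \<psi> \<in> gcarrier (graded_dual (poly_space m))"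
  shows "restrict_form (Dsh m) \<phi> = restrict_form (Dsh m) \<psi> \<longleftrightarrow> \<phi> - \<psi> \<in> Dsh' m"
  using assms by (auto simp: Dsh'_def restrict_form_def fun_eq_iff)

lemma diff_mem_graded_dual:
  assumes "\<phi> \<in> gcarrier (graded_dual V)" "\<psi> \<in> gcarrier (graded_dual V)"
  shows "\<phi> - \<psi> \<in> gcarrier (graded_dual V)"
proof -
  note V = graded_vector_space_graded_dual[of V]
  then have sub: "graded_subspace (graded_dual V) (gcarrier (graded_dual V))"
    by (simp add: graded_vector_space_def)
  then have "\<phi> + - \<psi> \<in> gcarrier (graded_dual V)"
    using assms minus_mem[OF V sub] unfolding graded_subspace_def by blast
  then show ?thesis by simp
qed

lemma h_map_diff:
  assumes "\<phi> \<in> gcarrier (graded_dual (poly_space m))" "\<psi> \<in> gcarrier (graded_dual (poly_space m))"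
  shows "h_map m (\<phi> - \<psi>) = h_map m \<phi> - h_map m \<psi>"
  by (rule poly_mapping_eqI)
    (simp add: lookup_minus lookup_h_map[OF assms(1)] lookup_h_map[OF assms(2)]
      lookup_h_map[OF diff_mem_graded_dual[OF assms]])

text \<open>The pairing of \<open>h_map m \<phi>\<close> with p is \<open>\<phi> p\<close>, so the
  annihilator description of W_R becomes vanishing on Dsh_m.\<close>

lemma h_map_in_W_R_iff:
  assumes m: "2 \<le> m" and \<phi>: "\<phi> \<in> gcarrier (graded_dual (poly_space m))"
  shows "h_map m \<phi> \<in> W_R_depth m \<longleftrightarrow> \<phi> \<in> Dsh' m"
proof -
  have m1: "1 \<le> m" using m by simp
  have "pair m (h_map m \<phi>) p = \<phi> p" if "p \<in> Dsh m" for p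
    using pair_h_map[OF \<phi> m1] subsetD[OF Dsh_subset_polys that] .
  then show ?thesis
    using W_R_iff_pair[OF m h_map_in_W_depth[OF \<phi> m1]] h_map_in_W_depth[OF \<phi> m1] \<phi>
    by (simp add: W_R_depth_def Dsh'_def)
qed

lemma g_map_coset:
  assumes "\<phi> \<in> gcarrier (graded_dual (poly_space m))"
  shows "g_map m (coset (graded_dual (poly_space m)) (Dsh' m) \<phi>) = restrict_form (Dsh m) \<phi>"
  unfolding g_map_def
  by (rule induced_coset[OF graded_vector_space_graded_dual graded_subspace_Dsh'])
    (subst restrict_form_eq_iff, auto simp: Dsh'_def)

text \<open>Forms with equal restrictions differ by an element of \<open>Dsh' m\<close>, so
  \<open>g_map\<close> is injective on cosets and the preimage picked by \<open>inv_into\<close> is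
  the expected one.\<close>

lemma g_inv_restrict_form:
  assumes \<phi>: "\<phi> \<in> gcarrier (graded_dual (poly_space m))"
  shows "g_inv m (restrict_form (Dsh m) \<phi>) = coset (graded_dual (poly_space m)) (Dsh' m) \<phi>"
proof -
  have carrier: "gcarrier (dual_mod_Dsh' m)
      = coset (graded_dual (poly_space m)) (Dsh' m) ` gcarrier (graded_dual (poly_space m))"
    by (simp add: dual_mod_Dsh'_def quotient_space_def)
  show ?thesis
    unfolding g_inv_def
  proof (rule inv_into_f_eq)
    show "inj_on (g_map m) (gcarrier (dual_mod_Dsh' m))"
      unfolding carrier
      by (rule inj_onI, elim imageE, hypsubst) (simp only: g_map_coset restrict_form_eq_iff
          diff_mem_graded_dual coset_eq_iff[OF graded_vector_space_graded_dual graded_subspace_Dsh'])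
  qed (use \<phi> in \<open>auto simp: carrier g_map_coset\<close>)
qed

lemma h_bar_coset:
  assumes m: "2 \<le> m" and \<phi>: "\<phi> \<in> gcarrier (graded_dual (poly_space m))"
  shows "h_bar m (coset (graded_dual (poly_space m)) (Dsh' m) \<phi>)
    = coset (W_depth_space m) (W_R_depth m) (h_map m \<phi>)"
  unfolding h_bar_def
proof (rule induced_coset[OF graded_vector_space_graded_dual graded_subspace_Dsh'])
  fix \<psi> assume D: "\<psi> - \<phi> \<in> Dsh' m"
  then have d: "\<psi> - \<phi> \<in> gcarrier (graded_dual (poly_space m))" by (simp add: Dsh'_def)
  \<comment> \<open>Closure under differences yields \<psi> as (\<psi> - \<phi>) - ((\<phi> -
    \<phi>) - \<phi>).\<close>
  have "(\<psi> - \<phi>) - - \<phi> \<in> gcarrier (graded_dual (poly_space m))"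
    using diff_mem_graded_dual[OF d diff_mem_graded_dual[OF diff_mem_graded_dual[OF \<phi> \<phi>] \<phi>]] by simp
  then have \<psi>: "\<psi> \<in> gcarrier (graded_dual (poly_space m))" by simp
  show "coset (W_depth_space m) (W_R_depth m) (h_map m \<psi>)
      = coset (W_depth_space m) (W_R_depth m) (h_map m \<phi>)"
    using D h_map_in_W_R_iff[OF m d]
    by (simp add: coset_eq_iff[OF graded_vector_space_W_depth_space graded_subspace_W_R_depth]
        h_map_diff[OF \<psi> \<phi>])
qed

lemma eta_free_eq: "eta_free w = - w"
proof -
  have "eta_free w = - (\<Sum>n\<in>Poly_Mapping.keys w. pscale (Poly_Mapping.lookup w n) (symb n))"
    by (simp add: eta_free_def sum_negf)
  then show ?thesis by (simp add: symb_def poly_mapping_sum_singles)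
qed

text \<open>As the relations of D span W_R, eta is negation of cosets. Intersection with W_m cuts -
  w + W_R down to the translate of the depth m part of W_R, because w lies in W_m.\<close>

lemma eta_depth_coset:
  fixes w :: "'k::field_char_0 symb"
  assumes w: "w \<in> W_depth m"
  shows "eta_depth m (coset W_space D_relations w) = coset (W_depth_space m) (W_R_depth m) (- w)"
proof -
  note W = graded_vector_space_W_space graded_subspace_W_R
  note W_depth = graded_vector_space_W_depth_space graded_subspace_W_R_depth
  have "eta (coset W_space W_R w) = coset W_space W_R (- w)"
    unfolding eta_def eta_free_eq
  proof (rule induced_coset[OF W])
    fix v assume "v - w \<in> W_R"
    then have "- (v - w) \<in> W_R" by (rule minus_mem[OF W])
    then show "coset W_space W_R (- v) = coset W_space W_R (- w)"
      by (simp add: coset_eq_iff[OF W])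
  qed
  moreover have "v + w \<in> W_depth m \<longleftrightarrow> v \<in> W_depth m" for v
    using w pm.subspace_add[OF pm_subspace_W_depth, of v m w]
      pm.subspace_diff[OF pm_subspace_W_depth, of "v + w" m w] by auto
  ultimately show ?thesis
    unfolding eta_depth_def D_relations_eq set_eq_iff Int_iff mem_coset_iff[OF W_depth]
    by (auto simp: mem_coset_iff[OF W] W_R_depth_def)
qed

lemma eta_inv_coset:
  fixes w :: "'k::field_char_0 symb"
  assumes w: "w \<in> W_depth m"
  shows "eta_inv m (coset (W_depth_space m) (W_R_depth m) w) = coset W_space D_relations (- w)"
  unfolding eta_inv_def
proof (rule inv_into_f_eq)
  note W = graded_vector_space_W_space graded_subspace_W_R
  note W_depth = graded_vector_space_W_depth_space graded_subspace_W_R_depth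
  have carrier: "gcarrier (D_depth_space m) = coset W_space D_relations ` W_depth m"
    by (simp add: D_depth_space_def)
  show "inj_on (eta_depth m) (gcarrier (D_depth_space m :: (nat, 'k, 'k symb set) graded_space))"
    unfolding carrier
  proof (rule inj_onI, elim imageE, hypsubst)
    fix u v :: "'k symb" assume uv: "u \<in> W_depth m" "v \<in> W_depth m"
      and "eta_depth m (coset W_space D_relations u) = eta_depth m (coset W_space D_relations v)"
    then have "- u - - v \<in> W_R_depth m" by (simp only: eta_depth_coset coset_eq_iff[OF W_depth])
    then have "- (- u - - v) \<in> W_R" by (intro minus_mem[OF W]) (simp add: W_R_depth_def)
    then show "coset W_space D_relations u = coset W_space D_relations v"
      by (simp add: D_relations_eq coset_eq_iff[OF W])
  qed
  have w': "- w \<in> W_depth m" using w by (rule pm.subspace_neg[OF pm_subspace_W_depth])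
  then show "coset W_space D_relations (- w) \<in> gcarrier (D_depth_space m)" by (simp add: carrier)
  show "eta_depth m (coset W_space D_relations (- w)) = coset (W_depth_space m) (W_R_depth m) w"
    using eta_depth_coset[OF w'] by simp
qed

text \<open>Negation maps every subspace onto itself, so the sign changes neither the image nor the
  components.\<close>

lemma graded_onto_D_depth_space:
  "graded_onto (W_depth_space m :: (nat, 'k::field_char_0, 'k symb) graded_space) (D_depth_space m)
     (\<lambda>w. coset W_space D_relations (- w))"
proof -
  note W = graded_vector_space_W_space graded_subspace_W_R
  have neg: "(\<lambda>w. coset W_space W_R (- w)) ` S = coset W_space W_R ` S"
    if S: "pm.subspace S" for S :: "'k symb set"
  proof -
    have "uminus ` S = S"
      using pm.subspace_neg[OF S] by (auto intro!: image_eqI[of x uminus "- x" for x])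
    then show ?thesis by (metis image_image)
  qed
  have D: "D_space = quotient_space W_space (W_R :: 'k symb set)"
    by (simp add: D_space_def D_relations_eq)
  have comp: "component (quotient_space W_space U) (m, k) = coset W_space U ` W_depth_wt m k"
    for U :: "'k symb set" and k
    by (simp add: quotient_space_def W_space_def)
  have scale: "gscale (W_space :: (_, 'k, _) graded_space) = pscale" by (simp add: W_space_def)
  show ?thesis
    by (simp add: graded_onto_def W_depth_space_def D_depth_space_def D D_relations_eq comp
        gadd_coset[OF W] gscale_coset[OF W] scale neg[OF pm_subspace_W_depth] neg[OF pm_subspace_W_depth_wt])
qed

theorem corollary7p4:
  fixes m :: nat
  assumes "2 \<le> m"
  shows
    "graded_iso (graded_dual (Dsh_space m :: (nat, 'k::field_char_0, 'k mpol) graded_space))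
       (W_mod_R m) (h_bar m \<circ> g_inv m) \<and>
     graded_iso (graded_dual (Dsh_space m :: (nat, 'k, 'k mpol) graded_space))
       (D_depth_space m) (eta_inv m \<circ> h_bar m \<circ> g_inv m)"
proof -
  let ?V = "graded_dual (poly_space m :: (nat, 'k, 'k mpol) graded_space)"
  let ?c = "coset (W_depth_space m) (W_R_depth m) :: 'k symb \<Rightarrow> _"
  let ?d = "\<lambda>w. coset W_space D_relations (- w) :: 'k symb set"
  have m: "1 \<le> m" using assms by simp
  note V = graded_vector_space_graded_dual[of "poly_space m :: (nat, 'k, 'k mpol) graded_space"]
  note W = graded_vector_space_W_space graded_subspace_W_R
  note W_depth = graded_vector_space_W_depth_space graded_subspace_W_R_depth
  have ker: "h_map m \<phi> - h_map m \<psi> \<in> W_R_depth m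
      \<longleftrightarrow> restrict_form (Dsh m) \<phi> = restrict_form (Dsh m) \<psi>"
    if "\<phi> \<in> gcarrier ?V" "\<psi> \<in> gcarrier ?V" for \<phi> \<psi>
    using h_map_in_W_R_iff[OF assms diff_mem_graded_dual[OF that]]
    by (simp add: h_map_diff[OF that] restrict_form_eq_iff[OF diff_mem_graded_dual[OF that]])
  have hg: "(h_bar m \<circ> g_inv m) (restrict_form (Dsh m) \<phi>) = ?c (h_map m \<phi>)"
    if "\<phi> \<in> gcarrier ?V" for \<phi>
    by (simp add: g_inv_restrict_form[OF that] h_bar_coset[OF assms that])
  have "graded_onto ?V (W_mod_R m) (\<lambda>\<phi>. ?c (h_map m \<phi>))"
    unfolding W_mod_R_def
    by (rule graded_onto_comp[OF V graded_onto_h_map[OF m] graded_onto_coset[OF W_depth]])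
  then have "graded_iso (graded_dual (Dsh_space m)) (W_mod_R m) (h_bar m \<circ> g_inv m :: _ \<Rightarrow> 'k symb set)"
    by (rule graded_iso_factor[OF V graded_onto_restrict_form])
      (simp_all only: hg coset_eq_iff[OF W_depth] ker)
  moreover have "graded_iso (graded_dual (Dsh_space m)) (D_depth_space m)
      (eta_inv m \<circ> h_bar m \<circ> g_inv m :: _ \<Rightarrow> 'k symb set)"
  proof (rule graded_iso_factor[OF V graded_onto_restrict_form])
    show "graded_onto ?V (D_depth_space m) (\<lambda>\<phi>. ?d (h_map m \<phi>))"
      by (rule graded_onto_comp[OF V graded_onto_h_map[OF m] graded_onto_D_depth_space])
    fix \<phi> \<psi> assume \<phi>: "\<phi> \<in> gcarrier ?V" and \<psi>: "\<psi> \<in> gcarrier ?V"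
    \<comment> \<open>D is a quotient by all of W_R, while \<open>ker\<close> speaks of its depth m
      part; for differences within W_m the two conditions agree.\<close>
    have "h_map m \<phi> - h_map m \<psi> \<in> W_depth m"
      by (intro pm.subspace_diff[OF pm_subspace_W_depth] h_map_in_W_depth m \<phi> \<psi>)
    then have "h_map m \<phi> - h_map m \<psi> \<in> W_R_depth m \<longleftrightarrow> h_map m \<phi> - h_map m \<psi> \<in> W_R"
      by (simp add: W_R_depth_def)
    also have "\<dots> \<longleftrightarrow> - h_map m \<phi> - - h_map m \<psi> \<in> W_R"
      using minus_mem[OF W, of "h_map m \<phi> - h_map m \<psi>"] minus_mem[OF W, of "- h_map m \<phi> - - h_map m \<psi>"]
      by auto
    finally show "?d (h_map m \<phi>) = ?d (h_map m \<psi>)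
        \<longleftrightarrow> restrict_form (Dsh m) \<phi> = restrict_form (Dsh m) \<psi>"
      by (simp only: D_relations_eq coset_eq_iff[OF W] ker[OF \<phi> \<psi>])
  next
    fix \<phi> assume \<phi>: "\<phi> \<in> gcarrier ?V"
    show "(eta_inv m \<circ> h_bar m \<circ> g_inv m) (restrict_form (Dsh m) \<phi>) = ?d (h_map m \<phi>)"
      using hg[OF \<phi>] by (simp add: eta_inv_coset[OF h_map_in_W_depth[OF \<phi> m]])
  qed
  ultimately show ?thesis by blast
qed

end
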